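(* For every integer $m\geq 2$, the power series $$\frac{1}{(q)_{\infty}}\left(h(q)-2^{m}h(q^{2^{m}})\right)$$ has positive coefficients for all positive powers of $q$; that is, for every integer $n\ge 1$ the coefficient of $q^n$ in this power series is strictly positive.
   Context: All series are formal power series in $q$ (equivalently, convergent series for $|q|<1$). The notation is $(a)_\infty=(a;q)_\infty=\prod_{n=1}^{\infty}(1-aq^{n-1})$, so $(q)_\infty=\prod_{n=1}^{\infty}(1-q^n)$. The function $h$ is defined by $$h(q)=\sum_{n=1}^{\infty}\frac{(-1)^{n+1}q^{n(n+1)/2}}{1-q^n},$$ and $h(q^k)$ denotes the series obtained by substituting $q^k$ for $q$ in $h(q)$. *)

theory Defs
  imports "HOL-Analysis.Analysis" "HOL-Computational_Algebra.Formal_Power_Series"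
begin

text \<open>
  Series in \<open>q\<close> are elements of \<open>real fps\<close> with \<open>q = fps_X\<close>; infinite sums and products are
  limits in the library's metric on formal power series (coefficientwise stabilisation).
  The lemmas below show that the ones used here converge, so that \<open>suminf\<close> and \<open>prodinf\<close>
  have their intended values.
\<close>

text \<open>\<open>(a; q)\<^sub>\<infinity>\<close>, with the factors \<open>1 - a q\<^bsup>n-1\<^esup>\<close>, \<open>n \<ge> 1\<close>, indexed from \<open>0\<close>.\<close>

definition qpochhammer_inf :: "real fps \<Rightarrow> real fps" where
  "qpochhammer_inf a = (\<Prod>n. 1 - a * fps_X ^ n)"

text \<open>The index \<open>n \<ge> 1\<close> is written \<open>Suc k\<close>.\<close>

definition h_term :: "nat \<Rightarrow> real fps" where
  "h_term n = (- 1) ^ (n + 1) * fps_X ^ (n * (n + 1) div 2) / (1 - fps_X ^ n)"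

definition h :: "real fps" where
  "h = (\<Sum>k. h_term (Suc k))"

lemma h_term_nth_eq_0:
  assumes "i \<le> k"
  shows "fps_nth (h_term (Suc k)) i = 0"
proof -
  have le: "Suc k \<le> Suc k * (Suc k + 1) div 2"
    using div_le_mono[of "Suc k * 2" "Suc k * (Suc k + 1)" 2] by (simp del: mult_Suc)
  have unit: "fps_nth (1 - fps_X ^ Suc k :: real fps) 0 \<noteq> 0"
    by simp
  have "h_term (Suc k) = fps_X ^ (Suc k * (Suc k + 1) div 2) *
          ((- 1) ^ (Suc k + 1) * inverse (1 - fps_X ^ Suc k))"
    unfolding h_term_def using fps_divide_unit[OF unit] by (simp only: mult_ac)
  also have "fps_nth (\<dots>) i = 0"
    unfolding fps_X_power_mult_nth using le assms by (subst if_P) (linarith, rule refl)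
  finally show ?thesis .
qed

lemma summable_h_term: "summable (\<lambda>k. h_term (Suc k))"
proof -
  define L where "L = Abs_fps (\<lambda>i. fps_nth (\<Sum>k<Suc i. h_term (Suc k)) i)"
  have "(\<lambda>n. \<Sum>k<n. h_term (Suc k)) \<longlonglongrightarrow> L"
    unfolding tendsto_fps_iff
  proof (intro allI)
    fix i
    show "\<forall>\<^sub>F n in sequentially. fps_nth (\<Sum>k<n. h_term (Suc k)) i = fps_nth L i"
      using eventually_ge_at_top[of "Suc i"]
    proof eventually_elim
      case (elim n)
      have "(\<Sum>k<n. fps_nth (h_term (Suc k)) i) = (\<Sum>k<Suc i. fps_nth (h_term (Suc k)) i)"
        using elim by (intro sum.mono_neutral_right) (auto simp: h_term_nth_eq_0)
      thus ?case by (simp add: L_def fps_sum_nth)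
    qed
  qed
  thus ?thesis by (auto simp: summable_def sums_def)
qed

lemma qpochhammer_inf_fps_X_has_prod:
  "(\<lambda>n. 1 - fps_X * fps_X ^ n) has_prod qpochhammer_inf fps_X"
proof -
  define P where "P = (\<lambda>n. \<Prod>k\<le>n. 1 - fps_X * fps_X ^ k :: real fps)"
  define L where "L = Abs_fps (\<lambda>i. fps_nth (P i) i)"
  have step: "fps_nth (P (Suc n)) i = fps_nth (P n) i" if "i \<le> n" for n i
  proof -
    have "P (Suc n) = P n - fps_X ^ (Suc (Suc n)) * P n"
      by (simp add: P_def algebra_simps)
    thus ?thesis using that by (simp only: fps_sub_nth fps_X_power_mult_nth) simp
  qed
  have stab: "fps_nth (P n) i = fps_nth (P i) i" if "i \<le> n" for n i
    using that by (induction n rule: dec_induct) (auto simp: step)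
  have lim: "P \<longlonglongrightarrow> L"
    unfolding tendsto_fps_iff
  proof (intro allI)
    fix i
    show "\<forall>\<^sub>F n in sequentially. fps_nth (P n) i = fps_nth L i"
      using eventually_ge_at_top[of i] by eventually_elim (simp add: L_def, rule stab)
  qed
  have "fps_nth L 0 = 1"
    by (simp add: L_def P_def)
  hence "L \<noteq> 0"
    by auto
  hence prod: "(\<lambda>n. 1 - fps_X * fps_X ^ n) has_prod L"
    using lim unfolding has_prod_def raw_has_prod_def P_def by simp
  show ?thesis
    unfolding qpochhammer_inf_def using prod has_prod_unique[OF prod] by simp
qed

end

theory Submission
  imports Defs
begin

text \<open>
  Put \<open>D(q) = h(q) - 2 h(q\<^sup>2)\<close>. Telescoping gives
  \<open>h(q) - 2\<^sup>m h(q^(2\<^sup>m)) = (\<Sum>j<m. 2\<^sup>j D(q^(2\<^sup>j)))\<close>, so each \<open>D(q\<^sup>k) / (q)\<^sub>\<infinity>\<close> can be treated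
  on its own. The theorem rests on the fact (\<open>smoothed_defect_nonneg\<close>) that three of the factors of
  \<open>1 / (q)\<^sub>\<infinity>\<close> already repair all negative coefficients of \<open>D\<close>: the series
  \<open>V(q) = D(q) / ((1 - q) (1 - q\<^sup>2) (1 - q\<^sup>3))\<close> has nonnegative coefficients. Since \<open>1 / (q)\<^sub>\<infinity>\<close> contains
  \<open>1 / ((1 - q\<^sup>k) (1 - q^(2k)) (1 - q^(3k)))\<close>, the series \<open>D(q\<^sup>k) / (q)\<^sub>\<infinity>\<close> is \<open>V(q\<^sup>k)\<close> times a product
  of geometric series. As \<open>V(q)\<close> begins with \<open>q\<close>, the summand \<open>j = 0\<close> has a positive coefficient at
  \<open>q\<close>; the summand \<open>j = 1\<close>, present because \<open>m \<ge> 2\<close>, begins with \<open>2 q\<^sup>2\<close> and its cofactor still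
  contains \<open>1 / (1 - q)\<close>, which makes all later coefficients positive.

  The coefficients of \<open>1 / ((1 - q) (1 - q\<^sup>2) (1 - q\<^sup>3))\<close> are \<open>(k + 3)\<^sup>2 / 12\<close> up to an error of at
  most \<open>1 / 3\<close>. Hence, with \<open>b\<close> the coefficients of \<open>D\<close> and \<open>y = x + 3\<close>, twelve times the coefficient
  of \<open>q\<^sup>x\<close> in \<open>V\<close> is \<open>T = (\<Sum>N\<le>y. b N (y - N)\<^sup>2)\<close> up to \<open>4 (\<Sum>N\<le>y. \<bar>b N\<bar>)\<close>. The latter is at most
  \<open>8 y\<close>, because \<open>h\<close> has nonnegative coefficients whose partial sums up to \<open>z\<close> are at most \<open>z\<close>
  (\<open>hcoeff_nonneg\<close>, \<open>sum_hcoeff_le\<close>).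

  To estimate \<open>T\<close>, expand every summand of \<open>h\<close> as a geometric series. The \<open>n\<close>-th row of \<open>h(q)\<close>
  becomes a midpoint Riemann sum with step \<open>n\<close> for \<open>(y - t)\<^sup>2\<close> on \<open>[n\<^sup>2 / 2, y]\<close>, the \<open>n\<close>-th row of
  \<open>h(q\<^sup>2)\<close> one with step \<open>2 n\<close> on \<open>[n\<^sup>2, y]\<close>. Replacing them by integrals leaves the alternating sum
  over \<open>n\<close> of the integral of \<open>(y - t)\<^sup>2 / n\<close> over \<open>[n\<^sup>2 / 2, n\<^sup>2]\<close>, truncated at \<open>t = y\<close>: the
  logarithmic terms of the two parts cancel. Substituting \<open>t = s n\<^sup>2\<close> turns it into an
  integral over \<open>s\<close> in \<open>[1 / 2, 1]\<close> of the sums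
  \<open>(\<Sum>n. (-1)^(n + 1) n (y - s n\<^sup>2)\<^sub>+\<^sup>2)\<close>, whose main term is \<open>y\<^sup>2 / 4\<close>, since \<open>1 - 2 + 3 - \<dots>\<close> has Abel sum
  \<open>1 / 4\<close>. So \<open>T\<close> is at least \<open>y\<^sup>2 / 8\<close> minus a term of order \<open>y^(3/2)\<close> (\<open>alternating_rows_lower\<close>), which beats \<open>8 y\<close>
  once \<open>x \<ge> 118\<close>. The first \<open>118\<close> coefficients of \<open>V\<close> are computed from a linear recurrence.
\<close>

section \<open>Alternating sums of truncated polynomials\<close>

lemma obtain_floor_sqrt:
  fixes Y :: real assumes "0 \<le> Y"
  obtains N :: nat where "real N ^ 2 \<le> Y" "Y < (real N + 1) ^ 2"
proof
  define N where "N = nat \<lfloor>sqrt Y\<rfloor>"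
  have 1: "real N \<le> sqrt Y" "sqrt Y < real N + 1"
    using assms by (auto simp: N_def)
  show "real N ^ 2 \<le> Y" using 1(1) assms
    by (metis of_nat_0_le_iff real_sqrt_pow2 power_mono)
  show "Y < (real N + 1) ^ 2" using 1(2) assms
    by (metis real_sqrt_pow2 power_strict_mono real_sqrt_ge_zero zero_less_numeral pos2)
qed

lemma alternating_sum_truncate:
  fixes Y :: real
  assumes N: "real N ^ 2 \<le> Y" "Y < (real N + 1) ^ 2" and K: "Y \<le> real K ^ 2" and p: "p > 0"
  shows "(\<Sum>n=1..K. (-1) ^ (n + 1) * (real n * max 0 (Y - real n ^ 2) ^ p)) =
         (\<Sum>n=1..N. (-1) ^ (n + 1) * (real n * (Y - real n ^ 2) ^ p))"
proof -
  have NK: "N \<le> K" using N(1) K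
    by (meson of_nat_0_le_iff of_nat_le_iff order_trans power2_le_imp_le)
  have "(\<Sum>n=1..K. (-1) ^ (n + 1) * (real n * max 0 (Y - real n ^ 2) ^ p)) =
        (\<Sum>n=1..N. (-1) ^ (n + 1) * (real n * max 0 (Y - real n ^ 2) ^ p))"
  proof (rule sum.mono_neutral_right)
    show "\<forall>n\<in>{1..K} - {1..N}. (-1) ^ (n + 1) * (real n * max 0 (Y - real n ^ 2) ^ p) = 0"
    proof
      fix n assume "n \<in> {1..K} - {1..N}"
      hence "real N + 1 \<le> real n" by auto
      hence "(real N + 1) ^ 2 \<le> real n ^ 2" by (intro power_mono) auto
      hence "max 0 (Y - real n ^ 2) = 0" using N(2) by linarith
      thus "(-1) ^ (n + 1) * (real n * max 0 (Y - real n ^ 2) ^ p) = 0" using p by simp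
    qed
  qed (use NK in auto)
  also have "\<dots> = (\<Sum>n=1..N. (-1) ^ (n + 1) * (real n * (Y - real n ^ 2) ^ p))"
  proof (rule sum.cong[OF refl])
    fix n assume "n \<in> {1..N}"
    hence "real n ^ 2 \<le> real N ^ 2" by (intro power_mono) auto
    hence "max 0 (Y - real n ^ 2) = Y - real n ^ 2" using N(1) by linarith
    thus "(-1) ^ (n + 1) * (real n * max 0 (Y - real n ^ 2) ^ p) =
       (-1) ^ (n + 1) * (real n * (Y - real n ^ 2) ^ p)" by simp
  qed
  finally show ?thesis .
qed

text \<open>
  The constants \<open>1 / 4\<close> and \<open>1 / 8\<close> come from the Abel sums \<open>1 / 4\<close> of \<open>\<Sum> (-1)^(n + 1) n\<close> and \<open>-1 / 8\<close> of
  \<open>\<Sum> (-1)^(n + 1) n\<^sup>3\<close>; the oscillating term is the Euler boundary correction at \<open>N\<close>.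
\<close>

lemma alternating_sum_linear_closed:
  fixes Y :: real
  shows "(\<Sum>n=1..N. (-1) ^ (n + 1) * (real n * (Y - real n ^ 2))) =
    Y / 4 + 1 / 8 + (-1) ^ N * ((4 * real N ^ 3 + 6 * real N ^ 2 - 1) / 8 - Y * (2 * real N + 1) / 4)"
  by (induction N) (auto simp: field_simps power2_eq_square power3_eq_cube)

text \<open>
  The further Abel sum needed here is \<open>1 / 4\<close>, that of \<open>\<Sum> (-1)^(n + 1) n\<^sup>5\<close>.
\<close>

lemma alternating_sum_square_closed:
  fixes Y :: real
  shows "(\<Sum>n=1..N. (-1) ^ (n + 1) * (real n * (Y - real n ^ 2) ^ 2)) =
    Y ^ 2 / 4 + Y / 4 + 1 / 4 - (-1) ^ N * (Y ^ 2 * (2 * real N + 1) -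
      Y * (4 * real N ^ 3 + 6 * real N ^ 2 - 1) +
      (2 * real N ^ 5 + 5 * real N ^ 4 - 5 * real N ^ 2 + 1)) / 4"
  by (induction N) (auto simp: field_simps power2_eq_square power3_eq_cube eval_nat_numeral)

text \<open>
  For fixed \<open>N = \<lfloor>sqrt Y\<rfloor>\<close> the boundary correction is affine in \<open>Y\<close>, so it suffices to bound it at the two
  ends \<open>N\<^sup>2\<close> and \<open>(N + 1)\<^sup>2\<close> of the range of \<open>Y\<close>.
\<close>

lemma alternating_sum_linear_bounds:
  fixes Y :: real
  assumes "0 \<le> Y" "Y \<le> real K ^ 2"
  defines "S \<equiv> (\<Sum>n=1..K. (-1) ^ (n + 1) * (real n * max 0 (Y - real n ^ 2)))"
  shows "- Y / 4 \<le> S" "S \<le> 3 * Y / 4 + 1 / 4"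
proof -
  obtain N where N: "real N ^ 2 \<le> Y" "Y < (real N + 1) ^ 2"
    using obtain_floor_sqrt[OF assms(1)] by blast
  define B where "B = (4 * real N ^ 3 + 6 * real N ^ 2 - 1) / 8 - Y * (2 * real N + 1) / 4"
  have S: "S = Y / 4 + 1 / 8 + (-1) ^ N * B"
    using alternating_sum_truncate[OF N assms(2), of 1] alternating_sum_linear_closed[where N=N and Y=Y]
    by (simp add: S_def B_def)
  have 1: "(Y - real N ^ 2) * (2 * real N + 3) \<ge> 0"
    using N by (intro mult_nonneg_nonneg) auto
  have 2: "((real N + 1) ^ 2 - Y) * (2 * real N - 1) \<ge> 0 \<or> N = 0"
    using N by (cases "N = 0") (auto intro!: mult_nonneg_nonneg)
  have up: "B \<le> Y / 2"
    using 1 by (simp add: B_def field_simps power2_eq_square power3_eq_cube)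
  have low: "- Y / 2 - 1 / 8 \<le> B"
  proof (cases "N = 0")
    case True
    thus ?thesis using N by (simp add: B_def)
  next
    case False
    thus ?thesis using 2 by (simp add: B_def field_simps power2_eq_square power3_eq_cube)
  qed
  have "\<bar>(-1) ^ N * B\<bar> \<le> Y / 2 + 1 / 8"
    using up low by (simp add: abs_mult abs_le_iff)
  thus "- Y / 4 \<le> S" "S \<le> 3 * Y / 4 + 1 / 4"
    unfolding S by linarith+
qed

text \<open>
  The summand has a double zero at \<open>n = sqrt Y\<close>, where the sum is cut off, so the boundary correction is
  only of order \<open>Y^(3/2)\<close> although individual terms reach order \<open>Y^(5/2)\<close>. In terms of
  \<open>m = \<lfloor>sqrt Y\<rfloor>\<close> and \<open>e = Y - m\<^sup>2\<close> four times the correction has, up to sign, the dominant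
  part \<open>2 m e (e - 2 m)\<close>, which is at least \<open>- 2 m\<^sup>3\<close>.
\<close>

lemma alternating_sum_square_lower:
  fixes Y :: real
  assumes "0 \<le> Y" "Y \<le> real K ^ 2"
  shows "(\<Sum>n=1..K. (-1) ^ (n + 1) * (real n * max 0 (Y - real n ^ 2) ^ 2)) \<ge>
         Y ^ 2 / 4 - Y * sqrt Y / 2 - Y"
proof -
  obtain N where N: "real N ^ 2 \<le> Y" "Y < (real N + 1) ^ 2"
    using obtain_floor_sqrt[OF assms(1)] by blast
  define e where "e = Y - real N ^ 2"
  define m where "m = real N"
  have e: "0 \<le> e" "e \<le> 2 * m + 1" and m: "m \<ge> 0"
    using N by (auto simp: e_def m_def power2_eq_square algebra_simps)
  define G where "G = 2 * m * e * (e - 2 * m) - 4 * m ^ 2 + e ^ 2 + e + 1"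
  have G: "Y ^ 2 * (2 * real N + 1) - Y * (4 * real N ^ 3 + 6 * real N ^ 2 - 1) +
      (2 * real N ^ 5 + 5 * real N ^ 4 - 5 * real N ^ 2 + 1) = G"
    unfolding G_def e_def m_def by (simp add: algebra_simps eval_nat_numeral)
  have sum: "(\<Sum>n=1..K. (-1) ^ (n + 1) * (real n * max 0 (Y - real n ^ 2) ^ 2)) =
      Y ^ 2 / 4 + Y / 4 + 1 / 4 - (-1) ^ N * G / 4"
    using alternating_sum_truncate[OF N assms(2), of 2] alternating_sum_square_closed[where N=N and Y=Y]
    unfolding G by simp
  have Y: "Y = m ^ 2 + e" by (simp add: e_def m_def)
  have "m \<le> sqrt Y" using N(1) by (simp add: m_def real_le_rsqrt)
  hence r: "m ^ 3 \<le> Y * sqrt Y"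
    using N(1) m unfolding power3_eq_cube m_def power2_eq_square
    using assms(1) by (intro mult_mono) auto
  have up: "G \<le> 5 * Y + 1"
  proof -
    have "2 * m * e * (e - 2 * m) \<le> 2 * m * e * 1"
      using e m by (intro mult_left_mono) auto
    moreover have "e * e \<le> (2 * m + 1) * e" using e by (intro mult_right_mono) auto
    moreover have "e * (4 * m - 3) \<le> 9 * m ^ 2"
    proof (cases "4 * m - 3 \<ge> 0")
      case True
      hence "e * (4 * m - 3) \<le> (2 * m + 1) * (4 * m - 3)" using e by (intro mult_right_mono) auto
      also have "\<dots> = 8 * m ^ 2 - 2 * m - 3" by (simp add: power2_eq_square algebra_simps)
      also have "\<dots> \<le> 9 * m ^ 2" using m zero_le_power2[of m] by linarith
      finally show ?thesis .
    next
      case False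
      hence "e * (4 * m - 3) \<le> 0" using e by (intro mult_nonneg_nonpos) auto
      also have "0 \<le> 9 * m ^ 2" by simp
      finally show ?thesis .
    qed
    ultimately show ?thesis unfolding G_def Y using e m
      by (simp add: power2_eq_square algebra_simps)
  qed
  have low: "- G \<le> 2 * m ^ 3 + 4 * Y"
  proof -
    have "m * (e - m) ^ 2 \<ge> 0" using m by simp
    hence "- (2 * m * e * (e - 2 * m)) \<le> 2 * m ^ 3"
      by (simp add: power2_eq_square power3_eq_cube algebra_simps)
    moreover have "m ^ 2 \<le> Y" using N by (simp add: m_def)
    ultimately show ?thesis unfolding G_def using e(1) zero_le_power2[of e] by linarith
  qed
  have "m ^ 3 \<ge> 0" using m by simp
  have "(-1) ^ N * G \<le> 5 * Y + 1 + 2 * (Y * sqrt Y)"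
  proof (cases "even N")
    case True
    hence "(-1) ^ N * G = G" by simp
    thus ?thesis using up r \<open>m ^ 3 \<ge> 0\<close> by linarith
  next
    case False
    hence "(-1) ^ N * G = - G" by simp
    thus ?thesis using low r assms(1) by linarith
  qed
  thus ?thesis unfolding sum by linarith
qed

section \<open>The midpoint rule for a truncated square\<close>

lemma sum_half_odd_squares:
  fixes u :: real
  shows "(\<Sum>j<J. (u - (real j + 1 / 2)) ^ 2) =
    real J * u ^ 2 - real J ^ 2 * u + real J * (4 * real J ^ 2 - 1) / 12"
  by (induction J) (auto simp: field_simps power2_eq_square)

lemma midpoint_cubic_bound:
  fixes v :: real
  assumes "- 1 / 2 \<le> v" "v \<le> 1 / 2"
  shows "\<bar>v ^ 3 / 3 - v / 12\<bar> \<le> 1 / 48"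
proof -
  have *: "0 \<le> t / 12 - t ^ 3 / 3 \<and> t / 12 - t ^ 3 / 3 \<le> 1 / 48" if "0 \<le> t" "t \<le> 1 / 2" for t :: real
  proof
    have "t * ((1 / 2 - t) * (1 / 2 + t)) \<ge> 0" using that by simp
    thus "0 \<le> t / 12 - t ^ 3 / 3" by (simp add: algebra_simps power3_eq_cube)
    \<comment> \<open>The maximum is at \<open>t = 1 / sqrt 12\<close>; the tangent of the cube at the nearby point \<open>3 / 10\<close> suffices.\<close>
    have "(t - 3 / 10) ^ 2 * (t + 3 / 5) \<ge> 0" using that by simp
    also have "(t - 3 / 10) ^ 2 * (t + 3 / 5) = t ^ 3 - 27 / 100 * t + 27 / 500"
      by (simp add: field_simps power3_eq_cube power2_eq_square)
    finally show "t / 12 - t ^ 3 / 3 \<le> 1 / 48"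
      using that by linarith
  qed
  show ?thesis
  proof (cases "v \<ge> 0")
    case True thus ?thesis using *[of v] assms by auto
  next
    case False thus ?thesis using *[of "-v"] assms by auto
  qed
qed

text \<open>
  The main term \<open>z\<^sup>3 / (3 t)\<close> is the integral divided by the step \<open>t\<close>, and \<open>- t z / 12\<close> is the usual
  second-order defect of the midpoint rule. With \<open>u = z / t\<close> written as an integer plus \<open>v\<close>,
  \<open>\<bar>v\<bar> \<le> 1 / 2\<close>, the remaining error is exactly \<open>t\<^sup>2\<close> times a cubic in \<open>v\<close>.
\<close>

lemma midpoint_sum_of_square:
  fixes t z :: real
  assumes t: "t > 0" and z: "z \<ge> 0" and K: "z \<le> t * real K"
  shows "\<bar>(\<Sum>j\<le>K. max 0 (z - t * (real j + 1 / 2)) ^ 2) - (z ^ 3 / (3 * t) - t * z / 12)\<bar> \<le> t ^ 2 / 48"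
proof -
  define u where "u = z / t"
  have zu: "z = t * u" using t by (simp add: u_def)
  have u: "u \<ge> 0" "u \<le> real K" using t z K by (auto simp: u_def field_simps)
  define J where "J = nat \<lfloor>u + 1 / 2\<rfloor>"
  have J: "real J \<le> u + 1 / 2" "u + 1 / 2 < real J + 1" using u by (auto simp: J_def)
  define v where "v = u - real J"
  have v: "- 1 / 2 \<le> v" "v \<le> 1 / 2" using J by (auto simp: v_def)
  have "real J < real (Suc K)" using J u by simp
  hence JK: "J \<le> K" by linarith
  have "(\<Sum>j\<le>K. max 0 (z - t * (real j + 1 / 2)) ^ 2) = (\<Sum>j<J. (z - t * (real j + 1 / 2)) ^ 2)"
  proof (intro sum.mono_neutral_cong_right ballI)
    fix j assume "j \<in> {..K} - {..<J}"
    hence "real J \<le> real j" by auto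
    hence "u - (real j + 1 / 2) \<le> 0" using J by linarith
    hence "t * (u - (real j + 1 / 2)) \<le> 0" using t by (simp add: mult_nonneg_nonpos)
    thus "max 0 (z - t * (real j + 1 / 2)) ^ 2 = 0" by (simp add: zu right_diff_distrib)
  next
    fix j assume "j \<in> {..<J}"
    hence "real j + 1 \<le> real J" by auto
    hence "u - (real j + 1 / 2) \<ge> 0" using J by linarith
    hence "t * (u - (real j + 1 / 2)) \<ge> 0" using t by simp
    thus "max 0 (z - t * (real j + 1 / 2)) ^ 2 = (z - t * (real j + 1 / 2)) ^ 2"
      by (simp add: zu right_diff_distrib)
  qed (use JK in auto)
  also have "\<dots> = t ^ 2 * (\<Sum>j<J. (u - (real j + 1 / 2)) ^ 2)"
    unfolding sum_distrib_left by (intro sum.cong) (auto simp: zu power2_eq_square algebra_simps)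
  also have "(\<Sum>j<J. (u - (real j + 1 / 2)) ^ 2) = u ^ 3 / 3 - u / 12 - (v ^ 3 / 3 - v / 12)"
    unfolding sum_half_odd_squares v_def by (simp add: field_simps power2_eq_square power3_eq_cube)
  also have "t ^ 2 * \<dots> = z ^ 3 / (3 * t) - t * z / 12 - t ^ 2 * (v ^ 3 / 3 - v / 12)"
    using t by (simp add: zu field_simps power2_eq_square power3_eq_cube)
  finally have "\<bar>(\<Sum>j\<le>K. max 0 (z - t * (real j + 1 / 2)) ^ 2) - (z ^ 3 / (3 * t) - t * z / 12)\<bar>
      = t ^ 2 * \<bar>v ^ 3 / 3 - v / 12\<bar>" by (simp add: abs_mult)
  also have "\<dots> \<le> t ^ 2 * (1 / 48)" using midpoint_cubic_bound[OF v] by (intro mult_left_mono) auto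
  finally show ?thesis by simp
qed

section \<open>The alternating sum of the midpoint rows\<close>

lemma max_0_cube_has_derivative:
  fixes a b s :: real
  shows "((\<lambda>s. max 0 (a - b * s) ^ 3) has_real_derivative - 3 * b * max 0 (a - b * s) ^ 2) (at s)"
proof -
  have pos: "((\<lambda>x::real. max 0 x ^ 3) has_real_derivative 3 * max 0 x ^ 2) (at x)" for x :: real
  proof (cases "x = 0")
    case False
    show ?thesis
    proof (cases "x > 0")
      case True
      have "((\<lambda>x::real. x ^ 3) has_real_derivative 3 * max 0 x ^ 2) (at x)"
        using True by (auto intro!: derivative_eq_intros)
      moreover have "eventually (\<lambda>y. y ^ 3 = max 0 y ^ 3) (nhds x)"
        using eventually_nhds_in_open[of "{0<..}" x] True by (auto elim!: eventually_mono)
      ultimately show ?thesis by (subst DERIV_cong_ev[OF refl _ refl, symmetric])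
    next
      case neg: False
      have "((\<lambda>x::real. 0) has_real_derivative 3 * max 0 x ^ 2) (at x)"
        using False neg by auto
      moreover have "eventually (\<lambda>y::real. 0 = max 0 y ^ 3) (nhds x)"
        using eventually_nhds_in_open[of "{..<0}" x] False neg by (auto elim!: eventually_mono)
      ultimately show ?thesis by (subst DERIV_cong_ev[OF refl _ refl, symmetric])
    qed
  next
    case True
    have "((\<lambda>h. (max 0 (0 + h) ^ 3 - max 0 0 ^ 3) / h) \<longlongrightarrow> (0::real)) (at 0)"
    proof (rule Lim_null_comparison)
      show "eventually (\<lambda>h::real. norm ((max 0 (0 + h) ^ 3 - max 0 0 ^ 3) / h) \<le> h ^ 2) (at 0)"
        by (rule always_eventually) (auto simp: max_def power3_eq_cube power2_eq_square)
      show "((\<lambda>h::real. h ^ 2) \<longlongrightarrow> 0) (at 0)" by (auto intro!: tendsto_eq_intros)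
    qed
    thus ?thesis using True by (simp add: DERIV_def)
  qed
  have "((\<lambda>s. a - b * s) has_real_derivative - b) (at s)"
    by (auto intro!: derivative_eq_intros)
  from DERIV_chain2[OF pos this] show ?thesis by (simp add: mult_ac)
qed

text \<open>
  Both sums are values of \<open>F(s) = (\<Sum>n. (-1)^(n + 1) (y - s n\<^sup>2)\<^sub>+\<^sup>3 / (3 n))\<close>, at \<open>s = 1 / 2\<close> and
  \<open>s = 1\<close>. Differentiating in \<open>s\<close> removes the denominators, and with them the logarithmic main terms of the
  two sums, so the mean value theorem reduces the difference to \<open>alternating_sum_square_lower\<close> at
  \<open>Y = y / s\<close>.
\<close>

lemma alternating_cube_difference:
  fixes y :: real
  assumes y: "0 \<le> y" and K: "2 * y \<le> real K ^ 2"
  shows "(\<Sum>n=1..K. (-1) ^ (n + 1) * (max 0 (y - real n ^ 2 / 2) ^ 3 / (3 * real n))) -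
         (\<Sum>n=1..K. (-1) ^ (n + 1) * (max 0 (y - real n ^ 2) ^ 3 / (3 * real n)))
         \<ge> y ^ 2 / 8 - y * sqrt y / 4 - y / 2"
proof -
  define F where "F = (\<lambda>s. \<Sum>n=1..K. (-1) ^ (n + 1) * (max 0 (y - real n ^ 2 * s) ^ 3 / (3 * real n)))"
  define F' where "F' = (\<lambda>s. \<Sum>n=1..K. (-1) ^ (n + 1) * (- 3 * real n ^ 2 * max 0 (y - real n ^ 2 * s) ^ 2 / (3 * real n)))"
  have der: "(F has_real_derivative F' s) (at s)" for s
    unfolding F_def F'_def
    by (intro DERIV_sum DERIV_cmult DERIV_cdivide max_0_cube_has_derivative)
  obtain s :: real where s: "1 / 2 < s" "s < 1" "F 1 - F (1 / 2) = (1 - 1 / 2) * F' s"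
    using MVT2[of "1 / 2" 1 F F'] der by auto
  define Y where "Y = y / s"
  have Y: "y = s * Y" "0 \<le> Y" using s y by (auto simp: Y_def)
  have "y * 1 \<le> y * (2 * s)" using s y by (intro mult_left_mono) auto
  hence "Y \<le> 2 * y" using s y by (simp add: Y_def field_simps)
  hence YK: "Y \<le> real K ^ 2" using K by linarith
  have "- F' s = s ^ 2 * (\<Sum>n=1..K. (-1) ^ (n + 1) * (real n * max 0 (Y - real n ^ 2) ^ 2))"
    unfolding F'_def sum_distrib_left sum_negf[symmetric]
  proof (rule sum.cong[OF refl])
    fix n assume n: "n \<in> {1..K}"
    have "y - real n ^ 2 * s = s * (Y - real n ^ 2)" by (simp add: Y algebra_simps)
    hence m: "max 0 (y - real n ^ 2 * s) = s * max 0 (Y - real n ^ 2)"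
      using s by (auto simp: max_def mult_le_0_iff zero_le_mult_iff)
    show "- ((-1) ^ (n + 1) * (- 3 * real n ^ 2 * max 0 (y - real n ^ 2 * s) ^ 2 / (3 * real n))) =
       s ^ 2 * ((-1) ^ (n + 1) * (real n * max 0 (Y - real n ^ 2) ^ 2))"
      using n unfolding m by (simp add: power2_eq_square)
  qed
  also have "\<dots> \<ge> s ^ 2 * (Y ^ 2 / 4 - Y * sqrt Y / 2 - Y)"
    by (intro mult_left_mono alternating_sum_square_lower Y YK) auto
  also (xtrans) have "s ^ 2 * (Y ^ 2 / 4 - Y * sqrt Y / 2 - Y) \<ge> y ^ 2 / 4 - y * sqrt y / 2 - y"
  proof -
    have sy: "sqrt y = sqrt s * sqrt Y" using Y by (simp add: real_sqrt_mult)
    have "s \<le> sqrt s" using s by (intro real_le_rsqrt) (auto simp: power2_eq_square mult_left_le)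
    hence "(s * (Y * sqrt Y)) * s \<le> (s * (Y * sqrt Y)) * sqrt s"
      using s Y by (intro mult_left_mono) auto
    moreover have "(s * Y) * s \<le> (s * Y) * 1" using s Y by (intro mult_left_mono) auto
    ultimately show ?thesis unfolding sy unfolding Y(1) by (simp add: algebra_simps power2_eq_square)
  qed
  finally have "- F' s \<ge> y ^ 2 / 4 - y * sqrt y / 2 - y" .
  hence "F (1 / 2) - F 1 \<ge> (y ^ 2 / 4 - y * sqrt y / 2 - y) / 2" using s(3) by (simp add: field_simps)
  thus ?thesis by (simp add: F_def field_simps)
qed

lemma sum_small_squares:
  fixes Y :: real
  assumes "0 \<le> Y"
  shows "(\<Sum>n=1..K. if real n ^ 2 \<le> Y then real n ^ 2 else 0) \<le> Y * sqrt Y"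
proof -
  obtain N where N: "real N ^ 2 \<le> Y" "Y < (real N + 1) ^ 2"
    using obtain_floor_sqrt[OF assms(1)] by blast
  have "(\<Sum>n=1..K. if real n ^ 2 \<le> Y then real n ^ 2 else 0) \<le> (\<Sum>n=1..K. if n \<in> {1..N} then Y else 0)"
  proof (rule sum_mono)
    fix n assume n: "n \<in> {1..K}"
    show "(if real n ^ 2 \<le> Y then real n ^ 2 else 0) \<le> (if n \<in> {1..N} then Y else 0)"
    proof (cases "real n ^ 2 \<le> Y")
      case True
      hence "real n ^ 2 < (real N + 1) ^ 2" using N(2) by linarith
      hence "real n < real N + 1" by (rule power2_less_imp_less) auto
      hence "n \<le> N" by linarith
      thus ?thesis using True n by auto
    qed (use assms in auto)
  qed
  also have "\<dots> = (\<Sum>n\<in>{1..K} \<inter> {1..N}. Y)" by (rule sum.inter_restrict[symmetric]) simp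
  also have "\<dots> \<le> (\<Sum>n\<in>{1..N}. Y)" by (intro sum_mono2) (use assms in auto)
  also have "\<dots> = Y * real N" by simp
  also have "\<dots> \<le> Y * sqrt Y" using N(1) assms by (intro mult_left_mono real_le_rsqrt) auto
  finally show ?thesis .
qed

text \<open>
  The version of \<open>midpoint_sum_of_square\<close> for the interval \<open>[q, y]\<close> that also covers the rows starting
  beyond \<open>y\<close>, which vanish.
\<close>

lemma midpoint_row_bound:
  fixes t y q :: real
  assumes t: "t > 0" and q: "q \<ge> 0" and K: "y \<le> t * real K"
  shows "\<bar>(\<Sum>j\<le>K. max 0 (y - q - t * (real j + 1 / 2)) ^ 2) -
     (max 0 (y - q) ^ 3 / (3 * t) - t * max 0 (y - q) / 12)\<bar> \<le> (if q \<le> y then t ^ 2 / 48 else 0)"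
proof (cases "q \<le> y")
  case True
  thus ?thesis using midpoint_sum_of_square[of t "y - q" K] assms by simp
next
  case False
  have "(\<Sum>j\<le>K. max 0 (y - q - t * (real j + 1 / 2)) ^ 2) = 0"
  proof (intro sum.neutral ballI)
    fix j
    have "t * (real j + 1 / 2) \<ge> 0" using t by simp
    thus "max 0 (y - q - t * (real j + 1 / 2)) ^ 2 = 0" using False by simp
  qed
  thus ?thesis using False by simp
qed

text \<open>
  Each row is replaced by its midpoint main terms. The cubic terms give the main term \<open>y\<^sup>2 / 8\<close>; the
  linear ones are alternating sums of order \<open>y\<close>, and the errors of the rows, of size
  \<open>n\<^sup>2\<close>, add up to order \<open>y^(3/2)\<close> without using any cancellation.
\<close>

lemma alternating_rows_lower:
  fixes y :: real and K :: nat
  assumes y: "1 \<le> y" and K: "2 * y \<le> real K ^ 2" "y \<le> real K"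
  shows "(\<Sum>n=1..K. (-1) ^ (n + 1) * (
            (\<Sum>j\<le>K. max 0 (y - real n ^ 2 / 2 - real n * (real j + 1 / 2)) ^ 2)
            - 2 * (\<Sum>j\<le>K. max 0 (y - real n ^ 2 - 2 * real n * (real j + 1 / 2)) ^ 2)))
         \<ge> y ^ 2 / 8 - y * sqrt y / 2 - y"
proof -
  define M1 where "M1 = (\<lambda>n. \<Sum>j\<le>K. max 0 (y - real n ^ 2 / 2 - real n * (real j + 1 / 2)) ^ 2)"
  define M2 where "M2 = (\<lambda>n. \<Sum>j\<le>K. max 0 (y - real n ^ 2 - 2 * real n * (real j + 1 / 2)) ^ 2)"
  define z1 where "z1 = (\<lambda>n. max 0 (y - real n ^ 2 / 2))"
  define z2 where "z2 = (\<lambda>n. max 0 (y - real n ^ 2))"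
  define e1 where "e1 = (\<lambda>n. if real n ^ 2 \<le> 2 * y then real n ^ 2 else 0)"
  define e2 where "e2 = (\<lambda>n. if real n ^ 2 \<le> y then real n ^ 2 else 0)"
  define S where "S = (\<lambda>f :: nat \<Rightarrow> real. \<Sum>n=1..K. (-1) ^ (n + 1) * f n)"
  define p1 where "p1 = (\<lambda>n. z1 n ^ 3 / (3 * real n))"
  define p2 where "p2 = (\<lambda>n. z2 n ^ 3 / (3 * real n))"
  define l1 where "l1 = (\<lambda>n. real n * z1 n)"
  define l2 where "l2 = (\<lambda>n. real n * z2 n)"
  have per_row: "(-1) ^ (n + 1) * (M1 n - 2 * M2 n) \<ge>
      (-1) ^ (n + 1) * p1 n - (-1) ^ (n + 1) * p2 n
      - ((-1) ^ (n + 1) * l1 n) / 12 + ((-1) ^ (n + 1) * l2 n) / 3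
      - e1 n / 48 - e2 n / 6" if n: "n \<in> {1..K}" for n
  proof -
    have n1: "real n \<ge> 1" using n by auto
    have K1: "y \<le> real n * real K"
      using K(2) mult_right_mono[OF n1, of "real K"] by simp
    hence K2: "y \<le> 2 * real n * real K" using y by linarith
    have 1: "\<bar>M1 n - (p1 n - l1 n / 12)\<bar> \<le> e1 n / 48"
      using midpoint_row_bound[of "real n" "real n ^ 2 / 2" y K] n1 K1
      unfolding M1_def z1_def e1_def p1_def l1_def by (simp split: if_splits)
    have p2: "z2 n ^ 3 / (3 * (2 * real n)) - 2 * real n * z2 n / 12 = p2 n / 2 - l2 n / 6"
      by (simp add: p2_def l2_def)
    have e2: "(if real n ^ 2 \<le> y then (2 * real n) ^ 2 / 48 else 0) = e2 n / 12"
      by (simp add: e2_def power2_eq_square)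
    have "\<bar>M2 n - (z2 n ^ 3 / (3 * (2 * real n)) - 2 * real n * z2 n / 12)\<bar> \<le>
       (if real n ^ 2 \<le> y then (2 * real n) ^ 2 / 48 else 0)"
      using midpoint_row_bound[of "2 * real n" "real n ^ 2" y K] n1 K2
      unfolding M2_def z2_def by simp
    hence 2: "\<bar>M2 n - (p2 n / 2 - l2 n / 6)\<bar> \<le> e2 n / 12"
      unfolding p2 e2 .
    have 3: "M1 n - 2 * M2 n \<le> p1 n - p2 n - l1 n / 12 + l2 n / 3 + e1 n / 48 + e2 n / 6"
      using abs_le_D1[OF 1] abs_le_D2[OF 2] by simp
    have 4: "M1 n - 2 * M2 n \<ge> p1 n - p2 n - l1 n / 12 + l2 n / 3 - e1 n / 48 - e2 n / 6"
      using abs_le_D2[OF 1] abs_le_D1[OF 2] by simp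
    show ?thesis
      using 3 4 by (cases "even n") simp_all
  qed
  have "(\<Sum>n=1..K. (-1) ^ (n + 1) * (M1 n - 2 * M2 n)) \<ge>
    (\<Sum>n=1..K. (-1) ^ (n + 1) * p1 n - (-1) ^ (n + 1) * p2 n
      - ((-1) ^ (n + 1) * l1 n) / 12 + ((-1) ^ (n + 1) * l2 n) / 3
      - e1 n / 48 - e2 n / 6)"
    by (rule sum_mono) (rule per_row)
  hence sum: "(\<Sum>n=1..K. (-1) ^ (n + 1) * (M1 n - 2 * M2 n)) \<ge>
      (S p1 - S p2) - S l1 / 12 + S l2 / 3
      - (\<Sum>n=1..K. e1 n) / 48 - (\<Sum>n=1..K. e2 n) / 6"
    unfolding S_def sum_subtractf sum.distrib sum_divide_distrib .
  have main: "S p1 - S p2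
      \<ge> y ^ 2 / 8 - y * sqrt y / 4 - y / 2"
    using alternating_cube_difference[of y K] y K unfolding S_def p1_def p2_def z1_def z2_def by simp
  have "S l1 = S (\<lambda>n. real n * max 0 (2 * y - real n ^ 2)) / 2"
    unfolding S_def sum_divide_distrib l1_def z1_def
    by (intro sum.cong) (auto simp: max_def)
  also have "\<dots> \<le> (3 * (2 * y) / 4 + 1 / 4) / 2"
    using alternating_sum_linear_bounds(2)[of "2 * y" K] y K unfolding S_def by simp
  finally have lin1: "S l1 \<le> 3 * y / 4 + 1 / 8" by simp
  have lin2: "S l2 \<ge> - y / 4"
    using alternating_sum_linear_bounds(1)[of y K] y K unfolding S_def l2_def z2_def by simp
  \<comment> \<open>The coefficients of \<open>y * sqrt y\<close> are \<open>1 / 4\<close>, at most \<open>3 / 48\<close> and \<open>1 / 6\<close>, together below \<open>1 / 2\<close>.\<close>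
  have "sqrt 2 \<le> 3 / 2" by (rule real_le_lsqrt) (auto simp: power2_eq_square)
  hence "sqrt 2 * sqrt y \<le> 3 / 2 * sqrt y" using y by (intro mult_right_mono) auto
  hence "2 * y * sqrt (2 * y) \<le> 2 * y * (3 / 2 * sqrt y)"
    using y by (intro mult_left_mono) (auto simp: real_sqrt_mult)
  hence err1: "(\<Sum>n=1..K. e1 n) \<le> 3 * (y * sqrt y)"
    using order_trans[OF sum_small_squares[of "2 * y" K]] y unfolding e1_def
    by (simp add: mult_ac)
  have err2: "(\<Sum>n=1..K. e2 n) \<le> y * sqrt y"
    using sum_small_squares[of y K] y unfolding e2_def by simp
  have "y * sqrt y \<ge> 0" using y by simp
  hence "(\<Sum>n=1..K. (-1) ^ (n + 1) * (M1 n - 2 * M2 n)) \<ge> y ^ 2 / 8 - y * sqrt y / 2 - y"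
    using sum main lin1 lin2 err1 err2 y \<open>y * sqrt y \<ge> 0\<close> by linarith
  thus ?thesis unfolding M1_def M2_def .
qed

section \<open>The coefficients of h\<close>

text \<open>
  The coefficients of \<open>h\<close>: expanding the summand of index \<open>n\<close> as a geometric series puts the
  sign \<open>(-1)^(n + 1)\<close> on every \<open>N = triangle n + n j\<close>.
\<close>

definition hcoeff :: "nat \<Rightarrow> int" where
  "hcoeff N = (\<Sum>n=1..N. if triangle n \<le> N \<and> n dvd N - triangle n then (-1) ^ (n + 1) else 0)"

text \<open>
  The coefficients of \<open>h(q) - 2 h(q\<^sup>2)\<close>.
\<close>

definition defect_coeff :: "nat \<Rightarrow> int" where
  "defect_coeff N = hcoeff N - (if even N then 2 * hcoeff (N div 2) else 0)"

lemma two_triangle: "2 * triangle n = n * (n + 1)"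
  by (simp add: triangle_def)

lemma of_nat_triangle: "real (triangle n) = real n ^ 2 / 2 + real n / 2"
proof -
  have "real (2 * triangle n) = real (n * (n + 1))" by (simp only: two_triangle)
  thus ?thesis by (simp add: power2_eq_square algebra_simps)
qed

lemma triangle_mono: "m \<le> n \<Longrightarrow> triangle m \<le> triangle n"
  unfolding triangle_def by (intro div_le_mono mult_le_mono) auto

lemma triangle_ge: "n \<le> triangle n"
  using two_triangle[of n] by (cases n) auto

lemma sum_hcoeff_rows:
  fixes G :: "nat \<Rightarrow> real"
  assumes G: "\<And>N. N > y \<Longrightarrow> G N = 0"
  shows "(\<Sum>N\<le>y. of_int (hcoeff N) * G N) =
         (\<Sum>n=1..y. (-1) ^ (n + 1) * (\<Sum>j\<le>y. G (triangle n + n * j)))"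
proof -
  define C where "C = (\<lambda>n N. triangle n \<le> N \<and> n dvd N - triangle n)"
  have h: "of_int (hcoeff N) * G N = (\<Sum>n=1..y. (-1) ^ (n + 1) * (if C n N then G N else 0))"
    if "N \<le> y" for N
  proof -
    have "hcoeff N = (\<Sum>n=1..y. if C n N then (-1) ^ (n + 1) else 0)"
      unfolding hcoeff_def C_def
    proof (rule sum.mono_neutral_cong_left)
      show "\<forall>n\<in>{1..y} - {1..N}. (if triangle n \<le> N \<and> n dvd N - triangle n then (-1) ^ (n + 1) else 0) = (0::int)"
        by (auto dest!: order_trans[OF triangle_ge])
    qed (use that in auto)
    thus ?thesis by (auto simp: sum_distrib_right intro!: sum.cong)
  qed
  have row: "(\<Sum>N\<le>y. if C n N then G N else 0) = (\<Sum>j\<le>y. G (triangle n + n * j))" if n: "n \<in> {1..y}" for n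
  proof -
    have "(\<Sum>N\<le>y. if C n N then G N else 0) = (\<Sum>N\<in>{N. N \<le> y \<and> C n N}. G N)"
      by (subst sum.inter_filter[symmetric]) auto
    also have "\<dots> = (\<Sum>j\<in>{j. triangle n + n * j \<le> y}. G (triangle n + n * j))"
      by (rule sum.reindex_bij_witness[of _ "\<lambda>j. triangle n + n * j" "\<lambda>N. (N - triangle n) div n"])
         (use n in \<open>auto simp: C_def\<close>)
    also have "\<dots> = (\<Sum>j\<le>y. G (triangle n + n * j))"
    proof (rule sum.mono_neutral_left)
      show "{j. triangle n + n * j \<le> y} \<subseteq> {..y}"
      proof
        fix j assume "j \<in> {j. triangle n + n * j \<le> y}"
        moreover have "j \<le> n * j" using n by simp
        ultimately show "j \<in> {..y}" unfolding mem_Collect_eq atMost_iff by linarith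
      qed
    qed (use G in auto)
    finally show ?thesis .
  qed
  have "(\<Sum>N\<le>y. of_int (hcoeff N) * G N) =
     (\<Sum>N\<le>y. \<Sum>n=1..y. (-1) ^ (n + 1) * (if C n N then G N else 0))"
    by (intro sum.cong refl h) auto
  also have "\<dots> = (\<Sum>n=1..y. (-1) ^ (n + 1) * (\<Sum>N\<le>y. if C n N then G N else 0))"
    by (subst sum.swap) (simp add: sum_distrib_left)
  also have "\<dots> = (\<Sum>n=1..y. (-1) ^ (n + 1) * (\<Sum>j\<le>y. G (triangle n + n * j)))"
    by (intro sum.cong refl) (simp add: row)
  finally show ?thesis .
qed

lemma alternating_sum_antimono_bounds:
  fixes c :: "nat \<Rightarrow> real"
  assumes "\<And>n. 0 \<le> c n" "\<And>n. c (Suc n) \<le> c n"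
  shows "0 \<le> (\<Sum>n<K. (-1) ^ n * c n) \<and> (\<Sum>n<K. (-1) ^ n * c n) \<le> c 0"
  using assms
proof (induction K arbitrary: c)
  case (Suc K)
  have "0 \<le> (\<Sum>n<K. (-1) ^ n * c (Suc n)) \<and> (\<Sum>n<K. (-1) ^ n * c (Suc n)) \<le> c (Suc 0)"
    using Suc.prems by (intro Suc.IH) auto
  moreover have "(\<Sum>n<Suc K. (-1) ^ n * c n) = c 0 - (\<Sum>n<K. (-1) ^ n * c (Suc n))"
    by (subst sum.lessThan_Suc_shift) (simp add: sum_negf)
  ultimately show ?case using Suc.prems(2)[of 0] by linarith
qed simp

text \<open>
  The left-hand side counts, with alternating signs over \<open>n\<close>, the \<open>j\<close> with \<open>triangle n + n j \<le> z\<close>.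
  These counts decrease in \<open>n\<close>, so the alternating sum is at most its first term, which is \<open>z\<close>.
\<close>

lemma sum_hcoeff_le: "(\<Sum>N\<le>z. hcoeff N) \<le> int z"
proof -
  define c :: "nat \<Rightarrow> real"
    where "c = (\<lambda>n. \<Sum>j\<le>z. if triangle (Suc n) + Suc n * j \<le> z then 1 else 0)"
  have dec: "c (Suc n) \<le> c n" for n
    unfolding c_def
  proof (rule sum_mono)
    fix j
    have "triangle (Suc n) + Suc n * j \<le> triangle (Suc (Suc n)) + Suc (Suc n) * j"
      by (intro add_mono triangle_mono mult_le_mono) auto
    thus "(if triangle (Suc (Suc n)) + Suc (Suc n) * j \<le> z then 1 else 0)
        \<le> (if triangle (Suc n) + Suc n * j \<le> z then 1 else (0::real))" by auto
  qed
  have "real_of_int (\<Sum>N\<le>z. hcoeff N) = (\<Sum>N\<le>z. of_int (hcoeff N) * (if N \<le> z then 1 else 0))"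
    by simp
  also have "\<dots> = (\<Sum>n=1..z. (-1) ^ (n + 1) * (\<Sum>j\<le>z. if triangle n + n * j \<le> z then 1 else 0))"
    by (rule sum_hcoeff_rows) auto
  also have "\<dots> = (\<Sum>n<z. (-1) ^ n * c n)"
    by (simp add: sum.atLeast1_atMost_eq c_def del: mult_Suc triangle_Suc)
  also have "\<dots> \<le> c 0"
    using alternating_sum_antimono_bounds[of c z] dec by (auto simp: c_def sum_nonneg)
  also have "c 0 = (\<Sum>j\<le>z. if j \<in> {..<z} then 1 else 0)"
    unfolding c_def by (intro sum.cong) (auto simp: triangle_def)
  also have "\<dots> = real z"
    by (subst sum.inter_restrict[symmetric]) (auto simp: Int_absorb1 subset_eq)
  finally show ?thesis by linarith
qed

text \<open>
  Since \<open>triangle n + n j = n (n + 1 + 2 j) / 2\<close>, the coefficient at \<open>N\<close> counts the factorisations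
  \<open>2 N = n l\<close> into factors \<open>n < l\<close> of opposite parity, with sign \<open>+\<close> for odd and \<open>-\<close> for even \<open>n\<close>. If
  \<open>2\<^sup>v\<close> is the exact power of \<open>2\<close> in \<open>2 N\<close>, an even factor \<open>n\<close> of this kind is a multiple of \<open>2\<^sup>v\<close>, and moving
  \<open>2\<^sup>v\<close> from \<open>n\<close> to \<open>l\<close> injects the negative factorisations into the positive ones.
\<close>

lemma hcoeff_nonneg: "0 \<le> hcoeff N"
proof (cases "N = 0")
  case True thus ?thesis by (simp add: hcoeff_def)
next
  case False
  \<comment> \<open>The small factors of the positive and of the negative factorisations, respectively.\<close>
  define A where "A = {n. \<exists>l. n < l \<and> odd n \<and> even l \<and> n * l = 2 * N}"
  define B where "B = {n. \<exists>l. n < l \<and> even n \<and> odd l \<and> n * l = 2 * N}"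
  have C: "(triangle n \<le> N \<and> n dvd N - triangle n) \<longleftrightarrow> (\<exists>l. n < l \<and> odd (n + l) \<and> n * l = 2 * N)" (is "?L \<longleftrightarrow> ?R")
    if n: "n \<ge> 1" for n
  proof
    assume ?L
    then obtain j where "N - triangle n = n * j" by (auto elim: dvdE)
    hence j: "N = triangle n + n * j" using \<open>?L\<close> by simp
    have "n * (n + 1 + 2 * j) = 2 * N" using two_triangle[of n] by (simp add: j algebra_simps)
    thus ?R by (intro exI[of _ "n + 1 + 2 * j"]) auto
  next
    assume ?R
    then obtain l where l: "n < l" "odd (n + l)" "n * l = 2 * N" by auto
    have "even (l - n - 1)" using l by auto
    then obtain j where "l - n - 1 = 2 * j" by (rule evenE)
    hence "l = n + 1 + 2 * j" using l by auto
    hence "2 * N = 2 * (triangle n + n * j)" using l two_triangle[of n] by (simp add: algebra_simps)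
    hence "N = triangle n + n * j" by simp
    thus ?L by simp
  qed
  have AB: "A \<subseteq> {1..N}" "B \<subseteq> {1..N}"
  proof -
    have "n \<in> {1..N}" if "n < l" "n * l = 2 * N" for n l
    proof -
      have "n \<noteq> 0" using that False by (intro notI) auto
      hence "n * 2 \<le> n * l" using that by (intro mult_le_mono2) linarith
      thus ?thesis using that \<open>n \<noteq> 0\<close> by auto
    qed
    thus "A \<subseteq> {1..N}" "B \<subseteq> {1..N}" unfolding A_def B_def by blast+
  qed
  have fin: "finite A" "finite B" using AB finite_subset by blast+
  have "hcoeff N = (\<Sum>n=1..N. (if n \<in> A then 1 else 0) - (if n \<in> B then 1 else 0))"
    unfolding hcoeff_def
  proof (rule sum.cong[OF refl])
    fix n assume "n \<in> {1..N}"
    hence n: "n \<ge> 1" by simp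
    show "(if triangle n \<le> N \<and> n dvd N - triangle n then (-1) ^ (n + 1) else 0) =
          (if n \<in> A then 1 else 0) - (if n \<in> B then 1 else (0::int))"
      unfolding C[OF n] A_def B_def by (cases "even n") auto
  qed
  also have "\<dots> = int (card A) - int (card B)"
    using AB by (simp add: sum_subtractf sum.inter_restrict[symmetric] Int_absorb1)
  finally have h: "hcoeff N = int (card A) - int (card B)" .
  define v where "v = multiplicity 2 (2 * N)"
  obtain M where vM: "2 * N = 2 ^ v * M" "odd M"
    using False unfolding v_def by (elim multiplicity_decompose'[of "2 * N" 2, rotated -1]) auto
  have v: "v \<noteq> 0"
  proof
    assume "v = 0"
    hence "2 * N = M" using vM by simp
    thus False using vM(2) by auto
  qed
  have split: "2 ^ v dvd n" if "even n" "odd l" "n * l = 2 * N" for n l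
  proof -
    have "coprime (2 ^ v) l" using that by simp
    moreover have "2 ^ v dvd n * l" using that vM by simp
    ultimately show ?thesis by (simp add: coprime_dvd_mult_left_iff)
  qed
  have "card B \<le> card A"
  proof (rule card_inj_on_le[of "\<lambda>n. n div 2 ^ v"])
    show "inj_on (\<lambda>n. n div 2 ^ v) B"
    proof (rule inj_onI)
      fix m n assume mn: "m \<in> B" "n \<in> B" "m div 2 ^ v = n div 2 ^ v"
      hence "2 ^ v dvd m" "2 ^ v dvd n" using split by (auto simp: B_def)
      thus "m = n" using mn(3) by (metis dvd_mult_div_cancel)
    qed
    show "(\<lambda>n. n div 2 ^ v) ` B \<subseteq> A"
    proof
      fix x assume "x \<in> (\<lambda>n. n div 2 ^ v) ` B"
      then obtain n l where nl: "n < l" "even n" "odd l" "n * l = 2 * N" "x = n div 2 ^ v"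
        by (auto simp: B_def)
      have n: "n = 2 ^ v * x" using split[OF nl(2-4)] nl(5) by simp
      have "2 ^ v * (x * l) = 2 ^ v * M" using nl(4) vM(1) n by (simp add: mult_ac)
      hence xl: "x * l = M" by simp
      hence "odd x" using vM by auto
      moreover have "x < 2 ^ v * l"
      proof -
        have "x \<le> n" using n by simp
        also have "n < l" by fact
        also have "l \<le> 2 ^ v * l" by simp
        finally show ?thesis .
      qed
      moreover have "even (2 ^ v * l)" using v by simp
      moreover have "x * (2 ^ v * l) = 2 * N" using nl(4) n by (simp add: mult_ac)
      ultimately show "x \<in> A" unfolding A_def by blast
    qed
  qed (rule fin)
  thus ?thesis using h by simp
qed

lemma sum_even_indices:
  fixes f :: "nat \<Rightarrow> 'a :: comm_monoid_add"
  shows "(\<Sum>N\<le>y. if even N then f (N div 2) else 0) = (\<Sum>N\<le>y div 2. f N)"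
proof -
  have "(\<Sum>N\<le>y. if even N then f (N div 2) else 0) = (\<Sum>N\<in>{N \<in> {..y}. even N}. f (N div 2))"
    by (subst sum.inter_filter[symmetric]) auto
  also have "\<dots> = (\<Sum>N\<le>y div 2. f N)"
    by (rule sum.reindex_bij_witness[of _ "\<lambda>N. 2 * N" "\<lambda>N. N div 2"]) (auto simp: div_le_mono)
  finally show ?thesis .
qed

lemma sum_abs_defect_coeff_le: "(\<Sum>N\<le>y. \<bar>defect_coeff N\<bar>) \<le> 2 * int y"
proof -
  have "(\<Sum>N\<le>y. \<bar>defect_coeff N\<bar>) \<le> (\<Sum>N\<le>y. hcoeff N + (if even N then 2 * hcoeff (N div 2) else 0))"
  proof (rule sum_mono)
    fix N
    show "\<bar>defect_coeff N\<bar> \<le> hcoeff N + (if even N then 2 * hcoeff (N div 2) else 0)"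
      using hcoeff_nonneg[of N] hcoeff_nonneg[of "N div 2"] by (simp add: defect_coeff_def abs_le_iff)
  qed
  also have "\<dots> = (\<Sum>N\<le>y. hcoeff N) + 2 * (\<Sum>N\<le>y div 2. hcoeff N)"
    using sum_even_indices[of "\<lambda>N. 2 * hcoeff N" y] by (simp add: sum.distrib sum_distrib_left)
  also have "\<dots> \<le> 2 * int y"
    using sum_hcoeff_le[of y] sum_hcoeff_le[of "y div 2"] by linarith
  finally show ?thesis .
qed

text \<open>
  With \<open>triangle n + n j = n\<^sup>2 / 2 + n (j + 1 / 2)\<close> the rows are seen to be the midpoint sums of
  \<open>alternating_rows_lower\<close>.
\<close>

lemma sum_defect_coeff_square_lower:
  assumes y: "y \<ge> 2"
  shows "(\<Sum>N\<le>y. of_int (defect_coeff N) * (real y - real N) ^ 2) \<ge>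
         real y ^ 2 / 8 - real y * sqrt (real y) / 2 - real y"
proof -
  define G where "G = (\<lambda>N. max 0 (real y - real N) ^ 2)"
  have G0: "G N = 0" if "N > y" for N using that by (simp add: G_def)
  have "(\<Sum>N\<le>y. of_int (defect_coeff N) * (real y - real N) ^ 2) = (\<Sum>N\<le>y. of_int (defect_coeff N) * G N)"
    by (intro sum.cong) (auto simp: G_def)
  also have "\<dots> = (\<Sum>N\<le>y. of_int (hcoeff N) * G N -
       (if even N then 2 * (of_int (hcoeff (N div 2)) * G (2 * (N div 2))) else 0))"
    by (intro sum.cong) (auto simp: defect_coeff_def algebra_simps)
  also have "\<dots> = (\<Sum>N\<le>y. of_int (hcoeff N) * G N) - 2 * (\<Sum>N\<le>y div 2. of_int (hcoeff N) * G (2 * N))"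
    using sum_even_indices[of "\<lambda>N. 2 * (of_int (hcoeff N) * G (2 * N))" y]
    by (simp add: sum_subtractf sum_distrib_left)
  also have "(\<Sum>N\<le>y div 2. of_int (hcoeff N) * G (2 * N)) = (\<Sum>N\<le>y. of_int (hcoeff N) * G (2 * N))"
    by (rule sum.mono_neutral_left) (auto simp: G0)
  also have "(\<Sum>N\<le>y. of_int (hcoeff N) * G (2 * N)) =
      (\<Sum>n=1..y. (-1) ^ (n + 1) * (\<Sum>j\<le>y. G (2 * (triangle n + n * j))))"
    by (rule sum_hcoeff_rows) (auto simp: G0)
  also have "(\<Sum>N\<le>y. of_int (hcoeff N) * G N) =
      (\<Sum>n=1..y. (-1) ^ (n + 1) * (\<Sum>j\<le>y. G (triangle n + n * j)))"
    by (rule sum_hcoeff_rows) (auto simp: G0)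
  also have "\<dots> - 2 * (\<Sum>n=1..y. (-1) ^ (n + 1) * (\<Sum>j\<le>y. G (2 * (triangle n + n * j)))) =
     (\<Sum>n=1..y. (-1) ^ (n + 1) * ((\<Sum>j\<le>y. G (triangle n + n * j))
          - 2 * (\<Sum>j\<le>y. G (2 * (triangle n + n * j)))))"
    by (simp add: sum_distrib_left sum_subtractf right_diff_distrib mult_ac)
  also have "\<dots> = (\<Sum>n=1..y. (-1) ^ (n + 1) * (
            (\<Sum>j\<le>y. max 0 (real y - real n ^ 2 / 2 - real n * (real j + 1 / 2)) ^ 2)
            - 2 * (\<Sum>j\<le>y. max 0 (real y - real n ^ 2 - 2 * real n * (real j + 1 / 2)) ^ 2)))"
  proof -
    have 1: "G (triangle n + n * j) = max 0 (real y - real n ^ 2 / 2 - real n * (real j + 1 / 2)) ^ 2" for n j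
      unfolding G_def of_nat_add of_nat_mult of_nat_triangle by (simp add: algebra_simps)
    have 2: "G (2 * (triangle n + n * j)) = max 0 (real y - real n ^ 2 - 2 * real n * (real j + 1 / 2)) ^ 2" for n j
      unfolding G_def of_nat_add of_nat_mult of_nat_triangle by (simp add: algebra_simps)
    show ?thesis unfolding 1 2 ..
  qed
  also have "\<dots> \<ge> real y ^ 2 / 8 - real y * sqrt (real y) / 2 - real y"
    by (rule alternating_rows_lower) (use y in \<open>auto simp: power2_eq_square\<close>)
  finally show ?thesis .
qed

section \<open>Partitions into parts of size at most three, and large coefficients\<close>

text \<open>
  The integer nearest to \<open>(k + 3)\<^sup>2 / 12\<close>, which is the number of partitions of \<open>k\<close> into parts of size at most
  \<open>3\<close>, that is, the coefficient of \<open>q\<^sup>k\<close> in \<open>1 / ((1 - q) (1 - q\<^sup>2) (1 - q\<^sup>3))\<close>; see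
  \<open>partitions_upto_3_fps\<close>.
\<close>

definition partitions_upto_3 :: "nat \<Rightarrow> nat" where
  "partitions_upto_3 k = (k ^ 2 + 6 * k + 15) div 12"

lemma partitions_upto_3_bounds: "\<bar>12 * int (partitions_upto_3 k) - (int k + 3) ^ 2\<bar> \<le> 4"
proof -
  have "\<forall>r\<in>{..<12::nat}. (r ^ 2 + 6) mod 12 \<in> {3, 6, 7, 10}"
    by (simp add: lessThan_nat_numeral)
  moreover have "(k + 3) mod 12 \<in> {..<12}" by simp
  ultimately have "(((k + 3) mod 12) ^ 2 + 6) mod 12 \<in> {3, 6, 7, 10}" by blast
  hence m: "((k + 3) ^ 2 + 6) mod 12 \<in> {3, 6, 7, 10}" by (metis mod_add_left_eq power_mod)
  have e: "k ^ 2 + 6 * k + 15 = (k + 3) ^ 2 + 6" by (simp add: power2_eq_square algebra_simps)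
  have "12 * partitions_upto_3 k + ((k + 3) ^ 2 + 6) mod 12 = (k + 3) ^ 2 + 6"
    unfolding partitions_upto_3_def e by (rule mult_div_mod_eq)
  hence "int (12 * partitions_upto_3 k + ((k + 3) ^ 2 + 6) mod 12) = int ((k + 3) ^ 2 + 6)"
    by (rule arg_cong)
  hence "12 * int (partitions_upto_3 k) + int (((k + 3) ^ 2 + 6) mod 12) = (int k + 3) ^ 2 + 6"
    by simp
  moreover have "3 \<le> int (((k + 3) ^ 2 + 6) mod 12)" "int (((k + 3) ^ 2 + 6) mod 12) \<le> 10"
    using m by auto
  ultimately show ?thesis by (simp add: abs_le_iff)
qed

text \<open>
  The sum is \<open>1 / 12\<close> of \<open>(\<Sum>N\<le>y. b N (y - N)\<^sup>2)\<close> with \<open>y = x + 3\<close>, up to the rounding errors. Extending the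
  range from \<open>x\<close> to \<open>y\<close> costs nothing extra, because \<open>(y - N)\<^sup>2 \<le> 4\<close> there. For \<open>s = sqrt y\<close> the estimates
  leave \<open>s\<^sup>2 (s\<^sup>2 / 8 - s / 2 - 9)\<close>, which is nonnegative for \<open>s \<ge> 11\<close>, i.e. \<open>y \<ge> 121\<close>.
\<close>

lemma smoothed_defect_coeff_nonneg_large:
  assumes x: "x \<ge> 118"
  shows "(\<Sum>N\<le>x. defect_coeff N * int (partitions_upto_3 (x - N))) \<ge> 0"
proof -
  define y where "y = x + 3"
  define r where "r = (\<lambda>N. if N \<le> x then 12 * int (partitions_upto_3 (x - N)) else 0)"
  have r: "\<bar>r N - (int y - int N) ^ 2\<bar> \<le> 4" if "N \<le> y" for N
  proof (cases "N \<le> x")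
    case True
    thus ?thesis using partitions_upto_3_bounds[of "x - N"]
      by (simp add: r_def y_def of_nat_diff algebra_simps)
  next
    case False
    hence "int y - int N \<in> {0, 1, 2}" using that by (auto simp: y_def)
    thus ?thesis using False by (auto simp: r_def)
  qed
  have "(\<Sum>N\<le>y. defect_coeff N * (int y - int N) ^ 2) - (\<Sum>N\<le>y. defect_coeff N * r N) =
     (\<Sum>N\<le>y. defect_coeff N * ((int y - int N) ^ 2 - r N))"
    by (simp add: sum_subtractf right_diff_distrib)
  also have "\<dots> \<le> (\<Sum>N\<le>y. \<bar>defect_coeff N\<bar> * 4)"
  proof (rule sum_mono)
    fix N assume "N \<in> {..y}"
    hence "\<bar>(int y - int N) ^ 2 - r N\<bar> \<le> 4" using r[of N] by (simp add: abs_minus_commute)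
    hence "\<bar>defect_coeff N\<bar> * \<bar>(int y - int N) ^ 2 - r N\<bar> \<le> \<bar>defect_coeff N\<bar> * 4" by (intro mult_left_mono) auto
    thus "defect_coeff N * ((int y - int N) ^ 2 - r N) \<le> \<bar>defect_coeff N\<bar> * 4"
      by (metis abs_le_D1 abs_mult)
  qed
  also have "\<dots> \<le> 8 * int y" using sum_abs_defect_coeff_le[of y] by (simp add: sum_distrib_right[symmetric])
  finally have 1: "(\<Sum>N\<le>y. defect_coeff N * r N) \<ge> (\<Sum>N\<le>y. defect_coeff N * (int y - int N) ^ 2) - 8 * int y"
    by linarith
  have "(\<Sum>N\<le>y. defect_coeff N * r N) = (\<Sum>N\<le>x. defect_coeff N * r N)"
    by (rule sum.mono_neutral_right) (auto simp: y_def r_def)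
  also have "\<dots> = 12 * (\<Sum>N\<le>x. defect_coeff N * int (partitions_upto_3 (x - N)))"
    by (simp add: r_def sum_distrib_left mult_ac)
  finally have 2: "(\<Sum>N\<le>y. defect_coeff N * r N) = \<dots>" .
  define s where "s = sqrt (real y)"
  have s: "s \<ge> 11" unfolding s_def using x by (intro real_le_rsqrt) (auto simp: y_def)
  have ys: "real y = s ^ 2" by (simp add: s_def)
  have "s * s \<ge> 11 * s" using s by (intro mult_right_mono) auto
  hence "s ^ 2 / 8 - s / 2 - 9 \<ge> 0"
    using s unfolding power2_eq_square by linarith
  hence "s ^ 2 * (s ^ 2 / 8 - s / 2 - 9) \<ge> 0" by simp
  hence "real y ^ 2 / 8 - real y * sqrt (real y) / 2 - real y \<ge> 8 * real y"
    unfolding s_def[symmetric] ys using s by (simp add: algebra_simps power2_eq_square)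
  hence "(\<Sum>N\<le>y. of_int (defect_coeff N) * (real y - real N) ^ 2) \<ge> 8 * real y"
    using sum_defect_coeff_square_lower[of y] by (simp add: y_def)
  also have "(\<Sum>N\<le>y. of_int (defect_coeff N) * (real y - real N) ^ 2) =
     real_of_int (\<Sum>N\<le>y. defect_coeff N * (int y - int N) ^ 2)" by simp
  finally have "8 * int y \<le> (\<Sum>N\<le>y. defect_coeff N * (int y - int N) ^ 2)" by linarith
  thus ?thesis using 1 2 by linarith
qed

section \<open>Power series with nonnegative coefficients and the partition product\<close>

definition nonneg_coeffs :: "real fps \<Rightarrow> bool" where
  "nonneg_coeffs f \<longleftrightarrow> (\<forall>n. 0 \<le> fps_nth f n)"

lemma nonneg_coeffs_mult: "nonneg_coeffs f \<Longrightarrow> nonneg_coeffs g \<Longrightarrow> nonneg_coeffs (f * g)"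
  by (auto simp: nonneg_coeffs_def fps_mult_nth intro!: sum_nonneg)

lemma nonneg_coeffs_prod: "(\<And>k. k \<in> A \<Longrightarrow> nonneg_coeffs (f k)) \<Longrightarrow> nonneg_coeffs (\<Prod>k\<in>A. f k)"
proof (induction A rule: infinite_finite_induct)
  case (insert x F)
  thus ?case by (simp add: nonneg_coeffs_mult)
qed (auto simp: nonneg_coeffs_def)

lemma fps_nth_0_prod:
  fixes f :: "'a \<Rightarrow> real fps"
  shows "(\<And>k. k \<in> A \<Longrightarrow> fps_nth (f k) 0 = 1) \<Longrightarrow> fps_nth (\<Prod>k\<in>A. f k) 0 = 1"
  by (induction A rule: infinite_finite_induct) auto

lemma nth_mult_ge_term:
  assumes "nonneg_coeffs f" "nonneg_coeffs g"
  shows "fps_nth f i * fps_nth g j \<le> fps_nth (f * g) (i + j)"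
  using member_le_sum[of i "{0..i + j}" "\<lambda>l. fps_nth f l * fps_nth g (i + j - l)"] assms
  by (simp add: fps_mult_nth nonneg_coeffs_def)

lemma inverse_one_minus_power:
  assumes k: "k \<ge> 1"
  shows "inverse (1 - fps_X ^ k :: real fps) = Abs_fps (\<lambda>i. if k dvd i then 1 else 0)"
proof (rule fps_inverse_unique, rule fps_ext)
  fix n
  show "fps_nth ((1 - fps_X ^ k) * Abs_fps (\<lambda>i. if k dvd i then 1 else 0) :: real fps) n = fps_nth 1 n"
  proof (cases "n < k")
    case True
    thus ?thesis using k by (auto simp: left_diff_distrib fps_X_power_mult_nth nat_dvd_not_less)
  next
    case False
    thus ?thesis using k by (auto simp: left_diff_distrib fps_X_power_mult_nth dvd_minus_self)
  qed
qed

lemma nonneg_coeffs_inverse_one_minus_power: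
  "k \<ge> 1 \<Longrightarrow> nonneg_coeffs (inverse (1 - fps_X ^ k))"
  by (simp add: inverse_one_minus_power nonneg_coeffs_def)

text \<open>
  Makes the infinite product accessible: a coefficient of its inverse can be read off from the inverse of
  a finite partial product.
\<close>

lemma fps_nth_inverse_cong:
  fixes f g :: "real fps"
  assumes "\<And>i. i \<le> n \<Longrightarrow> fps_nth f i = fps_nth g i" "fps_nth f 0 \<noteq> 0"
  shows "fps_nth (inverse f) n = fps_nth (inverse g) n"
proof -
  have g0: "fps_nth g 0 \<noteq> 0" using assms by auto
  have "inverse f - inverse g = (inverse f * inverse g) * (g - f)"
  proof -
    have "(inverse f * inverse g) * (g - f) = inverse f * (inverse g * g) - inverse g * (inverse f * f)"
      by (simp only: right_diff_distrib mult_ac)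
    also have "inverse f * f = 1" using assms(2) by (rule inverse_mult_eq_1)
    also have "inverse g * g = 1" using g0 by (rule inverse_mult_eq_1)
    finally show ?thesis by simp
  qed
  also have "fps_nth \<dots> n = 0"
    unfolding fps_mult_nth by (intro sum.neutral) (auto simp: assms)
  finally show ?thesis by simp
qed

lemma qpochhammer_inf_nth:
  assumes "i \<le> K"
  shows "fps_nth (qpochhammer_inf fps_X) i = fps_nth (\<Prod>k=1..K. 1 - fps_X ^ k) i"
proof -
  define P where "P = (\<lambda>K. \<Prod>k=1..K. 1 - fps_X ^ k :: real fps)"
  have stable: "fps_nth (P L) i = fps_nth (P K) i" if "K \<le> L" "i \<le> K" for K L
    using that
  proof (induction L rule: dec_induct)
    case (step L)
    have "P (Suc L) = P L - fps_X ^ Suc L * P L"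
      by (simp add: P_def algebra_simps)
    thus ?case using step by (simp only: fps_sub_nth fps_X_power_mult_nth) simp
  qed simp
  have "(\<lambda>n. \<Prod>k\<le>n. 1 - fps_X * fps_X ^ k) \<longlonglongrightarrow> qpochhammer_inf fps_X"
    by (rule has_prod_imp_tendsto[OF qpochhammer_inf_fps_X_has_prod])
  also have "(\<lambda>n. \<Prod>k\<le>n. 1 - fps_X * fps_X ^ k) = (\<lambda>n. P (Suc n))"
    unfolding P_def by (simp only: One_nat_def prod.atLeast1_atMost_eq lessThan_Suc_atMost power_Suc)
  finally have "\<forall>\<^sub>F n in sequentially. fps_nth (P (Suc n)) i = fps_nth (qpochhammer_inf fps_X) i"
    by (simp add: tendsto_fps_iff)
  then obtain n0 where "\<And>n. n \<ge> n0 \<Longrightarrow> fps_nth (P (Suc n)) i = fps_nth (qpochhammer_inf fps_X) i"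
    by (auto simp: eventually_sequentially)
  from this[of "max n0 K"] show ?thesis using stable[of K "Suc (max n0 K)"] assms
    by (simp add: P_def)
qed

text \<open>
  Multiplying by \<open>1 - q\<^sup>k\<close> for all \<open>k\<close> in \<open>A\<close> cancels these factors of \<open>1 / (q)\<^sub>\<infinity>\<close> and leaves a
  product of geometric series. If \<open>1 / (1 - q)\<close> is among those left, every coefficient is a partial sum of
  a nonnegative series with constant term \<open>1\<close>.
\<close>

lemma partition_quotient_nth:
  fixes A :: "nat set"
  assumes A: "finite A" "0 \<notin> A"
  defines "f \<equiv> inverse (qpochhammer_inf fps_X) * (\<Prod>k\<in>A. 1 - fps_X ^ k)"
  shows "0 \<le> fps_nth f n" "1 \<notin> A \<Longrightarrow> 1 \<le> fps_nth f n" "fps_nth f 0 = 1"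
proof -
  have f: "\<exists>K\<ge>n. A \<subseteq> {1..K} \<and> 1 \<le> K \<and> fps_nth f n = fps_nth (\<Prod>k\<in>{1..K}-A. inverse (1 - fps_X ^ k)) n" for n
  proof -
    define K where "K = Suc (n + \<Sum>A)"
    define P where "P = (\<Prod>k=1..K. 1 - fps_X ^ k :: real fps)"
    have "k \<le> K" if "k \<in> A" for k using member_le_sum[of k A "\<lambda>k. k"] that A by (simp add: K_def)
    moreover have "1 \<le> k" if "k \<in> A" for k using that A(2) by (cases k) auto
    ultimately have AK: "A \<subseteq> {1..K}" by auto
    have "fps_nth (inverse (qpochhammer_inf fps_X)) i = fps_nth (inverse P) i" if "i \<le> n" for i
    proof (rule fps_nth_inverse_cong)
      show "fps_nth (qpochhammer_inf fps_X) 0 \<noteq> 0"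
        using qpochhammer_inf_nth[of 0 0] by simp
      show "fps_nth (qpochhammer_inf fps_X) l = fps_nth P l" if "l \<le> i" for l
        unfolding P_def using that \<open>i \<le> n\<close> by (intro qpochhammer_inf_nth) (simp add: K_def)
    qed
    hence "fps_nth f n = fps_nth (inverse P * (\<Prod>k\<in>A. 1 - fps_X ^ k)) n"
      unfolding f_def fps_mult_nth by (intro sum.cong) auto
    also have "inverse P = (\<Prod>k\<in>{1..K}. inverse (1 - fps_X ^ k))"
    proof (rule fps_inverse_unique)
      have "P * (\<Prod>k\<in>{1..K}. inverse (1 - fps_X ^ k)) = (\<Prod>k\<in>{1..K}. (1 - fps_X ^ k) * inverse (1 - fps_X ^ k))"
        by (simp add: P_def prod.distrib)
      also have "\<dots> = 1" by (intro prod.neutral ballI inverse_mult_eq_1') auto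
      finally show "P * (\<Prod>k\<in>{1..K}. inverse (1 - fps_X ^ k)) = 1" .
    qed
    also have "\<dots> = (\<Prod>k\<in>{1..K} - A. inverse (1 - fps_X ^ k)) * (\<Prod>k\<in>A. inverse (1 - fps_X ^ k))"
      using AK by (intro prod.subset_diff) auto
    also have "\<dots> * (\<Prod>k\<in>A. 1 - fps_X ^ k) = (\<Prod>k\<in>{1..K} - A. inverse (1 - fps_X ^ k)) *
        (\<Prod>k\<in>A. inverse (1 - fps_X ^ k) * (1 - fps_X ^ k))"
      by (simp add: prod.distrib mult.assoc)
    also have "(\<Prod>k\<in>A. inverse (1 - fps_X ^ k) * (1 - fps_X ^ k)) = (1 :: real fps)"
    proof (intro prod.neutral ballI inverse_mult_eq_1)
      fix k assume "k \<in> A"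
      hence "k \<noteq> 0" using A(2) by metis
      thus "fps_nth (1 - fps_X ^ k :: real fps) 0 \<noteq> 0" by simp
    qed
    finally show ?thesis using AK by (intro exI[of _ K]) (auto simp: K_def)
  qed
  have nn: "nonneg_coeffs (\<Prod>k\<in>{1..K}-B. inverse (1 - fps_X ^ k))" for K B
    by (intro nonneg_coeffs_prod nonneg_coeffs_inverse_one_minus_power) auto
  have c0: "fps_nth (\<Prod>k\<in>{1..K}-B. inverse (1 - fps_X ^ k) :: real fps) 0 = 1" for K B
    by (rule fps_nth_0_prod) simp
  show "0 \<le> fps_nth f n" using f[of n] nn by (auto simp: nonneg_coeffs_def)
  show "fps_nth f 0 = 1" using f[of 0] c0 by metis
  assume "1 \<notin> A"
  obtain K where K: "1 \<le> K" "fps_nth f n = fps_nth (\<Prod>k\<in>{1..K}-A. inverse (1 - fps_X ^ k)) n"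
    using f[of n] by blast
  have "(\<Prod>k\<in>{1..K}-A. inverse (1 - fps_X ^ k :: real fps)) =
     inverse (1 - fps_X ^ 1) * (\<Prod>k\<in>{1..K}-insert 1 A. inverse (1 - fps_X ^ k))"
    using prod.remove[of "{1..K}-A" 1 "\<lambda>k. inverse (1 - fps_X ^ k :: real fps)"] K(1) \<open>1 \<notin> A\<close>
    by (simp add: Diff_insert[of _ "Suc 0" A])
  moreover have "fps_nth (inverse (1 - fps_X ^ 1) :: real fps) n *
      fps_nth (\<Prod>k\<in>{1..K}-insert 1 A. inverse (1 - fps_X ^ k)) 0 \<le>
      fps_nth (inverse (1 - fps_X ^ 1) * (\<Prod>k\<in>{1..K}-insert 1 A. inverse (1 - fps_X ^ k))) (n + 0)"
    by (intro nth_mult_ge_term nn nonneg_coeffs_inverse_one_minus_power) simp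
  moreover have "fps_nth (inverse (1 - fps_X ^ 1) :: real fps) n = 1"
    by (subst inverse_one_minus_power) auto
  ultimately show "1 \<le> fps_nth f n" using K(2) c0 by simp
qed

section \<open>The defect series and its smoothing\<close>

lemma fps_nth_compose_X_power:
  fixes f :: "real fps"
  assumes "k \<ge> 1"
  shows "fps_nth (f oo fps_X ^ k) n = (if k dvd n then fps_nth f (n div k) else 0)"
proof -
  have "fps_nth (f oo fps_X ^ k) n = (\<Sum>i=0..n. if n = k * i then fps_nth f i else 0)"
    by (auto simp: fps_compose_nth power_mult[symmetric] fps_X_power_nth intro!: sum.cong)
  also have "\<dots> = (if k dvd n then fps_nth f (n div k) else 0)"
  proof (cases "k dvd n")
    case True
    then obtain j where j: "n = k * j" by (elim dvdE)
    have "j \<le> n" using j assms by simp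
    have "(\<Sum>i=0..n. if n = k * i then fps_nth f i else 0) = (\<Sum>i=0..n. if j = i then fps_nth f i else 0)"
      using assms by (intro sum.cong) (auto simp: j)
    also have "\<dots> = fps_nth f j" using \<open>j \<le> n\<close> by simp
    finally show ?thesis using True assms j by simp
  next
    case False
    thus ?thesis by (auto intro!: sum.neutral)
  qed
  finally show ?thesis .
qed

lemma fps_nth_h: "fps_nth h N = of_int (hcoeff N)"
proof -
  have h_term_nth: "fps_nth (h_term n) N = (if triangle n \<le> N \<and> n dvd N - triangle n then (-1) ^ (n + 1) else 0)"
    if n: "n \<ge> 1" for n
  proof -
    have "h_term n = fps_X ^ triangle n * (fps_const ((-1) ^ (n + 1)) * inverse (1 - fps_X ^ n))"
      unfolding h_term_def using n
      by (subst fps_divide_unit) (auto simp: triangle_def fps_const_power[symmetric] fps_const_neg[symmetric] mult_ac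
              simp del: fps_const_power fps_const_neg)
    thus ?thesis by (simp add: fps_X_power_mult_nth inverse_one_minus_power[OF n])
  qed
  have "(\<lambda>n. \<Sum>k<n. h_term (Suc k)) \<longlonglongrightarrow> h"
    unfolding h_def using summable_h_term by (rule summable_LIMSEQ)
  hence "\<forall>\<^sub>F n in sequentially. fps_nth (\<Sum>k<n. h_term (Suc k)) N = fps_nth h N"
    by (simp add: tendsto_fps_iff)
  then obtain n0 where "\<And>n. n \<ge> n0 \<Longrightarrow> fps_nth (\<Sum>k<n. h_term (Suc k)) N = fps_nth h N"
    by (auto simp: eventually_sequentially)
  from this[of "max n0 N"] have "fps_nth h N = (\<Sum>k<max n0 N. fps_nth (h_term (Suc k)) N)"
    by (simp add: fps_sum_nth)
  also have "\<dots> = (\<Sum>k<N. fps_nth (h_term (Suc k)) N)"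
    by (rule sum.mono_neutral_right) (auto simp: h_term_nth_eq_0)
  also have "\<dots> = of_int (hcoeff N)"
    unfolding hcoeff_def of_int_sum One_nat_def sum.atLeast1_atMost_eq
    by (intro sum.cong) (simp_all add: h_term_nth del: triangle_Suc)
  finally show ?thesis .
qed

definition h_defect :: "real fps" where
  "h_defect = h - 2 * (h oo fps_X ^ 2)"

lemma h_defect_nth: "fps_nth h_defect N = of_int (defect_coeff N)"
  by (simp add: h_defect_def defect_coeff_def fps_nth_h fps_nth_compose_X_power numeral_fps_const)

text \<open>
  The series \<open>V\<close> of the introduction, defined by its coefficients; \<open>smoothed_defect_mult\<close> is the
  characterisation as a quotient.
\<close>

definition smoothed_defect :: "real fps" where
  "smoothed_defect = Abs_fps (\<lambda>x. of_int (\<Sum>N\<le>x. defect_coeff N * int (partitions_upto_3 (x - N))))"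

text \<open>
  Adding \<open>6\<close> to the argument changes the numerator by a multiple of \<open>12\<close>, so on every residue class
  modulo \<open>6\<close> the rounded quadratic is an honest quadratic polynomial.
\<close>

lemma partitions_upto_3_split:
  "partitions_upto_3 (6 * t + r) = 3 * t ^ 2 + t * r + 3 * t + partitions_upto_3 r"
proof -
  have "(6 * t + r) ^ 2 + 6 * (6 * t + r) + 15 = 12 * (3 * t ^ 2 + t * r + 3 * t) + (r ^ 2 + 6 * r + 15)"
    by (simp add: power2_eq_square algebra_simps)
  thus ?thesis unfolding partitions_upto_3_def by (simp only: div_mult_self4)
qed

lemma partitions_upto_3_recurrence:
  "partitions_upto_3 (i + 6) + partitions_upto_3 (i + 2) + partitions_upto_3 (i + 1) =
   partitions_upto_3 (i + 5) + partitions_upto_3 (i + 4) + partitions_upto_3 i"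
proof -
  define t r where "t = i div 6" and "r = i mod 6"
  have i: "i = 6 * t + r" and "r < 6" by (simp_all add: t_def r_def)
  hence r: "r \<in> {0, 1, 2, 3, 4, 5}" by auto
  have "partitions_upto_3 (r + 6) + partitions_upto_3 (r + 2) + partitions_upto_3 (r + 1) =
        partitions_upto_3 (r + 5) + partitions_upto_3 (r + 4) + partitions_upto_3 r"
    using r by (auto simp: partitions_upto_3_def power2_eq_square)
  thus ?thesis
    unfolding i add.assoc[of "6 * t"] partitions_upto_3_split by (simp add: algebra_simps)
qed

lemma partitions_upto_3_fps:
  "Abs_fps (\<lambda>k. real (partitions_upto_3 k)) * ((1 - fps_X) * (1 - fps_X ^ 2) * (1 - fps_X ^ 3)) = 1"
proof -
  define W where "W = Abs_fps (\<lambda>k. real (partitions_upto_3 k))"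
  have "W * ((1 - fps_X) * (1 - fps_X ^ 2) * (1 - fps_X ^ 3)) =
     W - fps_X ^ 1 * W - fps_X ^ 2 * W + fps_X ^ 4 * W + fps_X ^ 5 * W - fps_X ^ 6 * W"
    by (simp add: algebra_simps eval_nat_numeral)
  also have "\<dots> = 1"
  proof (rule fps_ext)
    fix n
    show "fps_nth (W - fps_X ^ 1 * W - fps_X ^ 2 * W + fps_X ^ 4 * W + fps_X ^ 5 * W - fps_X ^ 6 * W) n = fps_nth 1 n"
    proof (cases "n < 6")
      case True
      hence "n \<in> {0, 1, 2, 3, 4, 5}" by auto
      thus ?thesis
        unfolding fps_sub_nth fps_add_nth fps_X_power_mult_nth
        by (auto simp: W_def partitions_upto_3_def)
    next
      case False
      then obtain i where i: "n = i + 6" by (metis add.commute le_Suc_ex not_less)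
      have "real (partitions_upto_3 (i + 6) + partitions_upto_3 (i + 2) + partitions_upto_3 (i + 1)) =
            real (partitions_upto_3 (i + 5) + partitions_upto_3 (i + 4) + partitions_upto_3 i)"
        by (simp only: partitions_upto_3_recurrence)
      thus ?thesis
        unfolding fps_sub_nth fps_add_nth fps_X_power_mult_nth by (simp add: W_def i add.commute)
    qed
  qed
  finally show ?thesis by (simp add: W_def)
qed

lemma smoothed_defect_mult: "smoothed_defect * ((1 - fps_X) * (1 - fps_X ^ 2) * (1 - fps_X ^ 3)) = h_defect"
proof -
  have "smoothed_defect = h_defect * Abs_fps (\<lambda>k. real (partitions_upto_3 k))"
    by (rule fps_ext) (simp add: smoothed_defect_def fps_mult_nth h_defect_nth atLeast0AtMost)
  hence "smoothed_defect * ((1 - fps_X) * (1 - fps_X ^ 2) * (1 - fps_X ^ 3)) =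
      h_defect * (Abs_fps (\<lambda>k. real (partitions_upto_3 k)) * ((1 - fps_X) * (1 - fps_X ^ 2) * (1 - fps_X ^ 3)))"
    by (metis mult.assoc)
  thus ?thesis by (simp only: partitions_upto_3_fps mult_1_right)
qed

section \<open>The initial coefficients by computation\<close>

text \<open>
  Runs the recurrence whose characteristic polynomial is
  \<open>(1 - q) (1 - q\<^sup>2) (1 - q\<^sup>3) = 1 - q - q\<^sup>2 + q\<^sup>4 + q\<^sup>5 - q\<^sup>6\<close> with inhomogeneity given by the list,
  and checks the sign of every value; the other arguments are the last six values, the latest first.
\<close>

fun recurrence_nonneg :: "int list \<Rightarrow> int \<Rightarrow> int \<Rightarrow> int \<Rightarrow> int \<Rightarrow> int \<Rightarrow> int \<Rightarrow> bool" where
  "recurrence_nonneg [] a b c d e f = True"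
| "recurrence_nonneg (x # xs) a b c d e f =
     (let v = x + a + b - d - e + f in 0 \<le> v \<and> recurrence_nonneg xs v a b c d e)"

lemma recurrence_nonneg_sound:
  fixes u :: "nat \<Rightarrow> int"
  assumes "\<And>k. u (k + 6) = b k + u (k + 5) + u (k + 4) - u (k + 2) - u (k + 1) + u k"
  assumes "recurrence_nonneg (map b [m..<m + l]) (u (m + 5)) (u (m + 4)) (u (m + 3)) (u (m + 2)) (u (m + 1)) (u m)"
  assumes "k < l"
  shows "0 \<le> u (m + k + 6)"
  using assms(2,3)
proof (induction l arbitrary: m k)
  case (Suc l)
  have step: "0 \<le> u (m + 6)"
    "recurrence_nonneg (map b [Suc m..<Suc m + l]) (u (m + 6)) (u (m + 5)) (u (m + 4)) (u (m + 3)) (u (m + 2)) (u (m + 1))"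
  proof -
    have "[m..<m + Suc l] = m # [Suc m..<Suc m + l]" by (simp add: upt_conv_Cons)
    hence "recurrence_nonneg (b m # map b [Suc m..<Suc m + l])
       (u (m + 5)) (u (m + 4)) (u (m + 3)) (u (m + 2)) (u (m + 1)) (u m)"
      using Suc.prems(1) by (simp only: list.map)
    thus "0 \<le> u (m + 6)"
      "recurrence_nonneg (map b [Suc m..<Suc m + l]) (u (m + 6)) (u (m + 5)) (u (m + 4)) (u (m + 3)) (u (m + 2)) (u (m + 1))"
      unfolding recurrence_nonneg.simps Let_def assms(1)[of m, symmetric] by blast+
  qed
  show ?case
  proof (cases k)
    case 0
    thus ?thesis using step(1) by simp
  next
    case (Suc k')
    have idx: "m + 6 = Suc m + 5" "m + 5 = Suc m + 4" "m + 4 = Suc m + 3" "m + 3 = Suc m + 2" "m + 2 = Suc m + 1" "m + 1 = Suc m"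
      by simp_all
    have "0 \<le> u (Suc m + k' + 6)"
      using Suc.IH[of "Suc m" k'] step(2)[unfolded idx] Suc.prems(2) Suc by simp
    thus ?thesis using Suc by simp
  qed
qed simp

text \<open>
  The triples \<open>((-1)^(n + 1), n, triangle n)\<close> with \<open>triangle n < 120\<close>. The computation is done in
  type \<^typ>\<open>int\<close>, whose binary numerals are fast to rewrite.
\<close>

definition hcoeff_rows :: "(int \<times> int \<times> int) list" where
  "hcoeff_rows = [(1,1,1),(-1,2,3),(1,3,6),(-1,4,10),(1,5,15),(-1,6,21),(1,7,28),(-1,8,36),(1,9,45),
     (-1,10,55),(1,11,66),(-1,12,78),(1,13,91),(-1,14,105)]"

definition hcoeff_int :: "int \<Rightarrow> int" where
  "hcoeff_int N = sum_list (map (\<lambda>(s, n, t). if t \<le> N \<and> (N - t) mod n = 0 then s else 0) hcoeff_rows)"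

definition defect_coeff_int :: "int \<Rightarrow> int" where
  "defect_coeff_int N = hcoeff_int N - (if N mod 2 = 0 then 2 * hcoeff_int (N div 2) else 0)"

lemma hcoeff_rows_eq: "hcoeff_rows = map (\<lambda>n. ((-1) ^ (n + 1), int n, int (triangle n))) [1..<15]"
proof -
  have "[1..<15] = [1, 2, 3, 4, 5, 6, 7, 8, 9, 10, 11, 12, 13, 14 :: nat]"
    by (simp add: upt_conv_Cons)
  thus ?thesis unfolding hcoeff_rows_def triangle_def by simp
qed

lemma hcoeff_eq_int:
  assumes "N < 120"
  shows "hcoeff N = hcoeff_int (int N)"
proof -
  define c where "c = (\<lambda>n. if triangle n \<le> N \<and> n dvd N - triangle n then (-1) ^ (n + 1) else (0 :: int))"
  have z: "c n = 0" if "n > N \<or> n \<ge> 15" for n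
  proof -
    have "triangle n > N"
      using that
    proof
      assume "n > N"
      thus ?thesis using triangle_ge[of n] by linarith
    next
      assume "n \<ge> 15"
      hence "triangle 15 \<le> triangle n" by (rule triangle_mono)
      thus ?thesis using assms by (simp add: triangle_def)
    qed
    thus ?thesis by (simp add: c_def)
  qed
  have "hcoeff N = (\<Sum>n=1..N. c n)" by (simp add: hcoeff_def c_def)
  also have "\<dots> = (\<Sum>n\<in>{1..N} \<union> {1..<15}. c n)"
    by (rule sum.mono_neutral_left) (use z in auto)
  also have "\<dots> = (\<Sum>n\<in>set [1..<15]. c n)"
    by (rule sum.mono_neutral_right) (use z in auto)
  also have "\<dots> = sum_list (map c [1..<15])" by (rule sum.distinct_set_conv_list) simp
  also have "map c [1..<15] = map ((\<lambda>(s, n, t). if t \<le> int N \<and> (int N - t) mod n = 0 then s else 0) \<circ>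
       (\<lambda>n. ((-1) ^ (n + 1), int n, int (triangle n)))) [1..<15]"
  proof (rule map_cong[OF refl])
    fix n assume "n \<in> set [1..<15]"
    have "(n dvd N - triangle n) = ((int N - int (triangle n)) mod int n = 0)" if "triangle n \<le> N"
      using that by (metis of_nat_diff of_nat_dvd_iff mod_0_imp_dvd dvd_imp_mod_0)
    thus "c n = ((\<lambda>(s, n, t). if t \<le> int N \<and> (int N - t) mod n = 0 then s else 0) \<circ>
       (\<lambda>n. ((-1) ^ (n + 1), int n, int (triangle n)))) n"
      by (auto simp: c_def)
  qed
  also have "sum_list \<dots> = hcoeff_int (int N)"
    by (simp only: hcoeff_int_def hcoeff_rows_eq map_map)
  finally show ?thesis .
qed

lemma defect_coeff_eq_int:
  assumes N: "N < 120"
  shows "defect_coeff N = defect_coeff_int (int N)"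
proof -
  have "(int N mod 2 = 0) = even N" by presburger
  moreover have "int N div 2 = int (N div 2)" by (simp add: zdiv_int)
  moreover have "N div 2 < 120" using N by simp
  ultimately show ?thesis using N by (simp only: defect_coeff_def defect_coeff_int_def hcoeff_eq_int)
qed

lemma initial_check: "recurrence_nonneg (map defect_coeff_int [0..117]) 0 0 0 0 0 0"
  by code_simp

lemma initial_defect_coeff: "map defect_coeff [0..<118] = map defect_coeff_int [0..117]"
proof -
  have "map defect_coeff [0..<118] = map (defect_coeff_int \<circ> int) [0..<118]"
    by (rule map_cong) (auto simp: defect_coeff_eq_int)
  also have "\<dots> = map defect_coeff_int (map int [0..<118])" by simp
  also have "map int [0..<118] = [0..117]"
    by (rule nth_equalityI) auto
  finally show ?thesis .
qed

section \<open>Positivity\<close>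

text \<open>
  The sequence \<open>u\<close> is the coefficient sequence preceded by six zeros, so that the recurrence holds from the
  start.
\<close>

lemma smoothed_defect_nonneg: "0 \<le> fps_nth smoothed_defect x"
proof -
  define v where "v = (\<lambda>x. \<Sum>N\<le>x. defect_coeff N * int (partitions_upto_3 (x - N)))"
  have smoothed_defect_nth: "fps_nth smoothed_defect x = of_int (v x)" for x by (simp add: smoothed_defect_def v_def)
  define u where "u = (\<lambda>k. if k < 6 then 0 else v (k - 6))"
  have rec: "u (k + 6) = defect_coeff k + u (k + 5) + u (k + 4) - u (k + 2) - u (k + 1) + u k" for k
  proof -
    have defect: "h_defect = smoothed_defect - fps_X ^ 1 * smoothed_defect - fps_X ^ 2 * smoothed_defect + fps_X ^ 4 * smoothed_defect + fps_X ^ 5 * smoothed_defect - fps_X ^ 6 * smoothed_defect"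
      unfolding smoothed_defect_mult[symmetric] by (simp add: algebra_simps eval_nat_numeral)
    have shift: "fps_nth (fps_X ^ j * smoothed_defect) k = of_int (u (k + 6 - j))" if "j \<le> 6" for j
      using that by (auto simp: fps_X_power_mult_nth u_def smoothed_defect_nth intro!: arg_cong[of _ _ v])
    have "fps_nth (fps_X ^ 1 * smoothed_defect) k = of_int (u (k + 5))" "fps_nth (fps_X ^ 2 * smoothed_defect) k = of_int (u (k + 4))"
      "fps_nth (fps_X ^ 4 * smoothed_defect) k = of_int (u (k + 2))" "fps_nth (fps_X ^ 5 * smoothed_defect) k = of_int (u (k + 1))"
      "fps_nth (fps_X ^ 6 * smoothed_defect) k = of_int (u k)" "fps_nth smoothed_defect k = of_int (u (k + 6))"
      using shift[of 1] shift[of 2] shift[of 4] shift[of 5] shift[of 6] by (simp_all add: u_def smoothed_defect_nth)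
    hence "fps_nth h_defect k = of_int (u (k + 6)) - of_int (u (k + 5)) - of_int (u (k + 4))
       + of_int (u (k + 2)) + of_int (u (k + 1)) - of_int (u k)"
      unfolding defect fps_sub_nth fps_add_nth by (simp only:)
    hence "real_of_int (u (k + 6)) = of_int (defect_coeff k + u (k + 5) + u (k + 4) - u (k + 2) - u (k + 1) + u k)"
      by (simp add: h_defect_nth)
    thus ?thesis by (simp only: of_int_eq_iff)
  qed
  have "0 \<le> v x"
  proof (cases "x < 118")
    case True
    have "recurrence_nonneg (map defect_coeff [0..<0 + 118]) (u (0 + 5)) (u (0 + 4)) (u (0 + 3)) (u (0 + 2)) (u (0 + 1)) (u 0)"
      using initial_check by (simp add: initial_defect_coeff u_def)
    from recurrence_nonneg_sound[OF rec this True] show ?thesis by (simp add: u_def)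
  next
    case False
    thus ?thesis using smoothed_defect_coeff_nonneg_large[of x] by (simp add: v_def)
  qed
  thus ?thesis by (simp add: smoothed_defect_nth)
qed

lemma smoothed_defect_nth_1: "fps_nth smoothed_defect 1 = 1"
proof -
  have "defect_coeff 0 = 0" "defect_coeff 1 = 1"
    by (simp_all add: defect_coeff_def hcoeff_def)
  thus ?thesis by (simp add: smoothed_defect_def partitions_upto_3_def)
qed

lemma h_telescope:
  "h - 2 ^ m * (h oo fps_X ^ (2 ^ m)) = (\<Sum>j<m. fps_const (2 ^ j) * (h_defect oo fps_X ^ (2 ^ j)))"
proof (rule fps_ext)
  fix n
  have two: "(2 :: real fps) ^ m = fps_const (2 ^ m)"
    by (simp add: numeral_fps_const fps_const_power)
  have defect: "fps_nth (h_defect oo fps_X ^ (2 ^ j)) n = fps_nth (h oo fps_X ^ (2 ^ j)) n - 2 * fps_nth (h oo fps_X ^ (2 ^ Suc j)) n" for j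
  proof (cases "2 ^ j dvd n")
    case True
    then obtain i where i: "n = 2 ^ j * i" by (elim dvdE)
    have "2 ^ Suc j dvd n \<longleftrightarrow> even i" by (simp add: i mult.commute)
    thus ?thesis by (auto simp: fps_nth_compose_X_power h_defect_def numeral_fps_const i elim!: evenE)
  next
    case False
    hence "\<not> 2 ^ Suc j dvd n" by (meson dvd_trans le_imp_power_dvd le_SucI order_refl)
    thus ?thesis using False by (simp add: fps_nth_compose_X_power del: power_Suc)
  qed
  have "fps_nth (\<Sum>j<m. fps_const (2 ^ j) * (h_defect oo fps_X ^ (2 ^ j))) n =
      (\<Sum>j<m. 2 ^ j * fps_nth (h oo fps_X ^ (2 ^ j)) n - 2 ^ Suc j * fps_nth (h oo fps_X ^ (2 ^ Suc j)) n)"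
    unfolding fps_sum_nth by (intro sum.cong refl) (simp add: defect right_diff_distrib del: power_Suc, simp)
  also have "\<dots> = fps_nth (h oo fps_X ^ 1) n - 2 ^ m * fps_nth (h oo fps_X ^ (2 ^ m)) n"
    by (subst sum_lessThan_telescope') simp
  finally show "fps_nth (h - 2 ^ m * (h oo fps_X ^ (2 ^ m))) n = fps_nth (\<Sum>j<m. fps_const (2 ^ j) * (h_defect oo fps_X ^ (2 ^ j))) n"
    by (simp add: two)
qed

text \<open>
  Substituting \<open>q\<^sup>k\<close> for \<open>q\<close> in \<open>smoothed_defect_mult\<close> produces the factors \<open>1 - q\<^sup>k\<close>, \<open>1 - q^(2k)\<close> and
  \<open>1 - q^(3k)\<close>, all of which occur in \<open>(q)\<^sub>\<infinity>\<close>.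
\<close>

lemma partition_h_defect_compose:
  assumes k: "k \<ge> 1"
  shows "inverse (qpochhammer_inf fps_X) * (h_defect oo fps_X ^ k) =
     (inverse (qpochhammer_inf fps_X) * (\<Prod>i\<in>{k, 2 * k, 3 * k}. 1 - fps_X ^ i)) * (smoothed_defect oo fps_X ^ k)"
proof -
  have X0: "fps_nth (fps_X ^ k :: real fps) 0 = 0" using k by simp
  have pow: "(1 - fps_X ^ i) oo fps_X ^ k = (1 - fps_X ^ (i * k) :: real fps)" for i
    using X0 by (simp add: fps_compose_sub_distrib fps_compose_power[symmetric] power_mult[symmetric] mult.commute)
  have "h_defect oo fps_X ^ k = (smoothed_defect oo fps_X ^ k) * ((1 - fps_X ^ (1 * k)) * (1 - fps_X ^ (2 * k)) * (1 - fps_X ^ (3 * k)))"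
    unfolding smoothed_defect_mult[symmetric] pow[symmetric] fps_compose_mult_distrib[OF X0] by simp
  thus ?thesis using k by (simp add: mult_ac)
qed

theorem theorem1p1:
  fixes m n :: nat
  assumes "m \<ge> 2" and "n \<ge> 1"
  shows "fps_nth (1 / qpochhammer_inf fps_X * (h - 2 ^ m * (h oo fps_X ^ (2 ^ m)))) n > 0"
proof -
  define P where "P = inverse (qpochhammer_inf fps_X)"
  define Q where "Q = (\<lambda>k. P * (\<Prod>i\<in>{k, 2 * k, 3 * k}. 1 - fps_X ^ i))"
  define T where "T = (\<lambda>j::nat. Q (2 ^ j) * (smoothed_defect oo fps_X ^ (2 ^ j)))"
  have Q: "nonneg_coeffs (Q (2 ^ j))" for j
    using partition_quotient_nth(1)[of "{2 ^ j, 2 * 2 ^ j, 3 * 2 ^ j}"]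
    by (simp add: nonneg_coeffs_def Q_def P_def)
  have comp: "nonneg_coeffs (smoothed_defect oo fps_X ^ (2 ^ j))" for j
    by (simp add: nonneg_coeffs_def fps_nth_compose_X_power smoothed_defect_nonneg)
  have T: "0 \<le> fps_nth (T j) n" for j
    using nonneg_coeffs_mult[OF Q comp] by (simp add: T_def nonneg_coeffs_def)
  have "fps_nth (qpochhammer_inf fps_X) 0 \<noteq> 0"
    using qpochhammer_inf_nth[of 0 0] by simp
  hence "1 / qpochhammer_inf fps_X * (h - 2 ^ m * (h oo fps_X ^ (2 ^ m))) =
        P * (\<Sum>j<m. fps_const (2 ^ j) * (h_defect oo fps_X ^ (2 ^ j)))"
    unfolding h_telescope P_def by (simp add: fps_divide_unit)
  also have "\<dots> = (\<Sum>j<m. fps_const (2 ^ j) * (P * (h_defect oo fps_X ^ (2 ^ j))))"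
    by (simp add: sum_distrib_left mult_ac)
  also have "\<dots> = (\<Sum>j<m. fps_const (2 ^ j) * T j)"
    unfolding T_def Q_def P_def by (intro sum.cong refl arg_cong2[of _ _ _ _ "(*)"] partition_h_defect_compose) simp
  finally have eq: "fps_nth (1 / qpochhammer_inf fps_X * (h - 2 ^ m * (h oo fps_X ^ (2 ^ m)))) n =
     (\<Sum>j<m. 2 ^ j * fps_nth (T j) n)" by (simp add: fps_sum_nth)
  have "\<exists>j<m. 0 < fps_nth (T j) n"
  proof (cases "n = 1")
    case True
    have "fps_nth (Q (2 ^ 0)) 0 * fps_nth (smoothed_defect oo fps_X ^ (2 ^ 0)) 1 \<le> fps_nth (T 0) (0 + 1)"
      unfolding T_def by (intro nth_mult_ge_term Q comp)
    moreover have "fps_nth (Q (2 ^ 0)) 0 = 1"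
      unfolding Q_def P_def by (rule partition_quotient_nth(3)) auto
    moreover have "fps_nth (smoothed_defect oo fps_X ^ (2 ^ 0)) 1 = 1" using smoothed_defect_nth_1 by simp
    ultimately show ?thesis using True assms(1) by (intro exI[of _ 0]) simp
  next
    case False
    hence "n \<ge> 2" using assms(2) by simp
    then obtain i where i: "n = i + 2" by (metis le_add_diff_inverse2)
    have "fps_nth (Q (2 ^ 1)) i * fps_nth (smoothed_defect oo fps_X ^ (2 ^ 1)) 2 \<le> fps_nth (T 1) (i + 2)"
      unfolding T_def by (intro nth_mult_ge_term Q comp)
    moreover have "1 \<le> fps_nth (Q (2 ^ 1)) i"
      unfolding Q_def P_def by (rule partition_quotient_nth(2)) auto
    moreover have "fps_nth (smoothed_defect oo fps_X ^ (2 ^ 1)) 2 = 1" using smoothed_defect_nth_1 by (simp add: fps_nth_compose_X_power)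
    ultimately show ?thesis using assms(1) unfolding i by (intro exI[of _ 1]) simp
  qed
  thus ?thesis unfolding eq using T by (auto intro!: sum_pos2)
qed

end
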